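(* Let $\Omega\subset\mathbb{R}^n$ be a bounded domain, and consider the Laplacian on $\Omega$ with Neumann boundary conditions. Suppose that $\varphi$ and $\psi$ are two eigenfunctions corresponding to the same eigenvalue $\mu$. If their nodal sets do not intersect, then $H_1(\Omega)\neq0$.
   Context: Eigenfunctions are real-valued solutions of $-\Delta\varphi=\mu\varphi$ in $\Omega$ with $\partial_\eta\varphi=0$ on $\partial\Omega$ ($\eta$ the outward unit normal); the boundary is assumed reasonably regular so that the spectrum is discrete. The nodal set of an eigenfunction is its zero set, points of $\partial\Omega$ included. $H_1$ denotes first homology.
   Formalization: Assumes μ ≠ 0: for μ = 0, two constants on a ball have empty nodal sets although H_1 = 0. The "reasonably regular" boundary is read as Lipschitz and C^1 off a set of codimension at least two; eigenfunctions are classical solutions with finite Dirichlet energy. *)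

theory Defs
  imports "HOL-Analysis.Analysis" "HOL-Homology.Homology"
begin

text \<open>Classical differential operators on a Euclidean space.\<close>

definition grad :: "('a::euclidean_space \<Rightarrow> real) \<Rightarrow> 'a \<Rightarrow> 'a" where
  "grad f x = (THE D. GDERIV f x :> D)"

lemma grad_eqI:
  fixes f :: "'a::euclidean_space \<Rightarrow> real"
  assumes "GDERIV f x :> D"
  shows "grad f x = D"
  unfolding grad_def
proof (rule the_equality, rule assms)
  fix E assume "GDERIV f x :> E"
  with assms have "(\<lambda>h. h \<bullet> D) = (\<lambda>h. h \<bullet> E)"
    unfolding gderiv_def by (rule has_derivative_unique)
  then have "h \<bullet> D = h \<bullet> E" for h by meson
  then show "E = D" by (metis vector_eq_rdot inner_commute)
qed

definition C1_on :: "'a::euclidean_space set \<Rightarrow> ('a \<Rightarrow> real) \<Rightarrow> bool" where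
  "C1_on S f \<longleftrightarrow> (\<forall>x\<in>S. GDERIV f x :> grad f x) \<and> continuous_on S (grad f)"

definition C2_on :: "'a::euclidean_space set \<Rightarrow> ('a \<Rightarrow> real) \<Rightarrow> bool" where
  "C2_on S f \<longleftrightarrow> C1_on S f \<and> (\<forall>b\<in>Basis. C1_on S (\<lambda>x. grad f x \<bullet> b))"

definition laplacian :: "('a::euclidean_space \<Rightarrow> real) \<Rightarrow> 'a \<Rightarrow> real" where
  "laplacian f x = (\<Sum>b\<in>Basis. grad (\<lambda>y. grad f y \<bullet> b) x \<bullet> b)"

text \<open>
  The vector \<open>\<nu>\<close> is the outward unit normal at a boundary point near which \<open>\<Omega>\<close> is the
  sublevel set of a \<open>C\<^sup>1\<close> function without critical points, i.e. near which \<open>\<Omega>\<close> has a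
  \<open>C\<^sup>1\<close> boundary and lies on one side of it.  The function \<open>\<rho>\<close> vanishes at \<open>x\<close>, because
  \<open>x\<close> is a limit of points of the open set \<open>\<Omega>\<close> without belonging to it.
\<close>

definition outward_unit_normal :: "'a::euclidean_space set \<Rightarrow> 'a \<Rightarrow> 'a \<Rightarrow> bool" where
  "outward_unit_normal \<Omega> x \<nu> \<longleftrightarrow>
     x \<in> frontier \<Omega> \<and>
     (\<exists>U \<rho>. open U \<and> x \<in> U \<and> C1_on U \<rho> \<and> (\<forall>y\<in>U. grad \<rho> y \<noteq> 0) \<and>
            \<Omega> \<inter> U = {y \<in> U. \<rho> y < 0} \<and> \<nu> = grad \<rho> x /\<^sub>R norm (grad \<rho> x))"

definition regular_boundary :: "'a::euclidean_space set \<Rightarrow> 'a set" where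
  "regular_boundary \<Omega> = {x \<in> frontier \<Omega>. \<exists>\<nu>. outward_unit_normal \<Omega> x \<nu>}"

definition singular_boundary :: "'a::euclidean_space set \<Rightarrow> 'a set" where
  "singular_boundary \<Omega> = frontier \<Omega> - regular_boundary \<Omega>"

text \<open>
  Locally, \<open>\<Omega>\<close> is the region below the graph, in some direction \<open>e\<close>, of a Lipschitz function
  of the component \<open>y - (y \<bullet> e) *\<^sub>R e\<close> of \<open>y\<close> orthogonal to \<open>e\<close>.
\<close>

definition Lipschitz_boundary :: "'a::euclidean_space set \<Rightarrow> bool" where
  "Lipschitz_boundary \<Omega> \<longleftrightarrow>
     (\<forall>x\<in>frontier \<Omega>. \<exists>U e g L. open U \<and> x \<in> U \<and> norm e = 1 \<and> L-lipschitz_on UNIV (g :: 'a \<Rightarrow> real) \<and>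
        \<Omega> \<inter> U = {y \<in> U. y \<bullet> e < g (y - (y \<bullet> e) *\<^sub>R e)})"

text \<open>
  The regularity of the boundary: Lipschitz, and \<open>C\<^sup>1\<close> away from a set of codimension at least
  two (vertices, edges, ...), the codimension being measured by Minkowski content.  All bounded
  domains with \<open>C\<^sup>1\<close> boundary (for which the singular set is empty) and all Lipschitz polygons
  and polyhedra are included.  The Lipschitz condition makes the embedding of \<open>H\<^sup>1\<close> into
  \<open>L\<^sup>2\<close> compact (Rellich), so the Neumann spectrum of such a domain is discrete.
\<close>

definition piecewise_C1_boundary :: "'a::euclidean_space set \<Rightarrow> bool" where
  "piecewise_C1_boundary \<Omega> \<longleftrightarrow>
     Lipschitz_boundary \<Omega> \<and>
     (\<exists>C. \<forall>\<epsilon>. 0 < \<epsilon> \<and> \<epsilon> \<le> 1 \<longrightarrow>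
        measure lebesgue (\<Union>x\<in>singular_boundary \<Omega>. ball x \<epsilon>) \<le> C * \<epsilon>\<^sup>2)"

text \<open>
  The gradient has a continuous extension \<open>G\<close> to the regular part of the boundary (unique, as
  boundary points are limits of points of \<open>\<Omega>\<close>), and its normal component vanishes there.
\<close>

definition neumann_condition :: "'a::euclidean_space set \<Rightarrow> ('a \<Rightarrow> real) \<Rightarrow> bool" where
  "neumann_condition \<Omega> f \<longleftrightarrow>
     (\<exists>G. continuous_on (\<Omega> \<union> regular_boundary \<Omega>) G \<and>
          (\<forall>x\<in>\<Omega>. G x = grad f x) \<and>
          (\<forall>x \<nu>. outward_unit_normal \<Omega> x \<nu> \<longrightarrow> G x \<bullet> \<nu> = 0))"

text \<open>
  Only the values of \<open>f\<close> on the closure of \<open>\<Omega>\<close> matter.  The integrability of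
  \<open>|grad f|\<^sup>2\<close> is the usual membership of an eigenfunction in \<open>H\<^sup>1(\<Omega>)\<close>; it is a condition at
  the singular boundary points only, and follows from the other clauses when there are none.
\<close>

definition neumann_eigenfunction ::
    "'a::euclidean_space set \<Rightarrow> real \<Rightarrow> ('a \<Rightarrow> real) \<Rightarrow> bool" where
  "neumann_eigenfunction \<Omega> \<mu> f \<longleftrightarrow>
     (\<exists>x\<in>\<Omega>. f x \<noteq> 0) \<and>
     continuous_on (closure \<Omega>) f \<and>
     C2_on \<Omega> f \<and>
     (\<forall>x\<in>\<Omega>. - laplacian f x = \<mu> * f x) \<and>
     neumann_condition \<Omega> f \<and>
     set_integrable lborel \<Omega> (\<lambda>x. (norm (grad f x))\<^sup>2)"

definition nodal_set :: "'a::euclidean_space set \<Rightarrow> ('a \<Rightarrow> real) \<Rightarrow> 'a set" where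
  "nodal_set \<Omega> f = {x \<in> closure \<Omega>. f x = 0}"

end

theory Submission
  imports Defs
begin

text \<open>
  Suppose that \<open>H\<^sub>1(\<Omega>) = 0\<close>.  The map \<open>u = \<phi> + i \<psi>\<close> has no zero on the closure of \<open>\<Omega>\<close>, and
  the change of \<open>log u\<close> along a path extends to singular 1-chains and vanishes on boundaries;
  so it vanishes on loops and \<open>u = |u| exp(i \<theta>)\<close> with a global argument \<open>\<theta>\<close> on \<open>\<Omega>\<close>.  The
  field \<open>X = \<phi> \<nabla>\<psi> - \<psi> \<nabla>\<phi> = |u|\<^sup>2 \<nabla>\<theta>\<close> is divergence free and tangential at the boundary, so
  \<open>0 = \<integral> div (arctan \<theta> X) = \<integral> |X|\<^sup>2 / (|u|\<^sup>2 (1 + \<theta>\<^sup>2))\<close>.  Hence \<open>\<theta>\<close> is constant and \<open>\<phi>\<close> has one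
  sign, contradicting \<open>\<integral> \<phi> = 0\<close>, which holds because \<open>\<mu> \<noteq> 0\<close>.

  The divergence theorem is localised by bump functions.  At a regular boundary point, where
  \<open>\<Omega> = {\<rho> < 0}\<close>, the field is multiplied by a cutoff depending on \<open>\<rho> / \<delta>\<close>; the resulting boundary
  layer is controlled by applying the same cutoff to a constant transversal field.  The singular
  set is cut off at distance \<open>r\<close>, where the volume \<open>O(r\<^sup>2)\<close> of the layer compensates for
  gradients of size \<open>1/r\<close>.
\<close>

subsection \<open>Logarithms on spaces with trivial first homology\<close>

text \<open>The common eigenvalue makes \<open>X\<close> divergence free, and a single-valued
  \<theta> makes it a positive multiple of a gradient; a field that is both and has no boundary flux
  must vanish. On an annulus the pair f(r) cos(k a), f(r) sin(k a) with f > 0 shows what happens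
  when \<theta> is multivalued. For \<mu> = 0 two nonzero constants have empty nodal sets, which
  explains the assumption \<mu> \<noteq> 0. Vanishing H_1 does not make loops contractible, so the
  change of the logarithm is treated as a cochain on singular chains instead of being followed along
  homotopies. On the analytic side no surface measure occurs: the flux of a field is the volume
  integral of div(\<zeta> Y) for test functions \<zeta>. A cutoff at depth \<delta> has a gradient
  of order 1/\<delta>, so a small normal component helps only if the weighted mass of the layer
  stays bounded as \<delta> tends to 0. The transversal constant field yields this bound without any
  estimate of the volume of the layer.\<close>

lemma continuous_log_increment_unique:
  fixes g h :: "'a::topological_space \<Rightarrow> complex"
  assumes "connected S" "continuous_on S g" "continuous_on S h"
    and eq: "\<And>t. t \<in> S \<Longrightarrow> exp (g t) = exp (h t)"
    and "a \<in> S" "b \<in> S"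
  shows "g b - g a = h b - h a"
proof -
  let ?d = "\<lambda>t. g t - h t"
  have int: "\<exists>n::int. ?d t = of_real (2 * pi * n) * \<i>" if "t \<in> S" for t
  proof -
    from eq[OF that] obtain n :: int where "g t = h t + (of_int (2 * n) * pi) * \<i>"
      by (auto simp: exp_eq)
    then show ?thesis by (intro exI[of _ n]) (simp add: algebra_simps)
  qed
  \<comment> \<open>The two logarithms have the same exponential, so \<open>?d\<close> takes values
    in 2 pi i Z. Distinct values are at least 2 pi apart, which a continuous function on a connected
    set can only satisfy by being constant.\<close>
  have "?d constant_on S"
  proof (rule continuous_discrete_range_constant[OF \<open>connected S\<close>])
    show "continuous_on S ?d" using assms by (intro continuous_intros)
    fix x assume x: "x \<in> S"
    show "\<exists>e>0. \<forall>y. y \<in> S \<and> ?d y \<noteq> ?d x \<longrightarrow> e \<le> norm (?d y - ?d x)"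
    proof (intro exI[of _ "2 * pi"] conjI allI impI)
      fix y assume y: "y \<in> S \<and> ?d y \<noteq> ?d x"
      obtain m n :: int where mn: "?d x = of_real (2 * pi * m) * \<i>" "?d y = of_real (2 * pi * n) * \<i>"
        using int x y by meson
      then have "m \<noteq> n" using y by auto
      then have "1 \<le> \<bar>real_of_int (n - m)\<bar>" by linarith
      moreover have "?d y - ?d x = of_real (2 * pi * (n - m)) * \<i>"
        unfolding mn by (simp add: algebra_simps)
      then have "norm (?d y - ?d x) = 2 * pi * \<bar>real_of_int (n - m)\<bar>"
        by (simp only: norm_mult norm_of_real norm_ii abs_mult) simp
      ultimately show "2 * pi \<le> norm (?d y - ?d x)" by simp
    qed simp
  qed
  then have "?d a = ?d b" using assms unfolding constant_on_def by metis
  then show ?thesis by (simp add: algebra_simps)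
qed

text \<open>The \<open>THE\<close> has a proper value as soon as \<gamma> has some continuous
  logarithm on \<open>{0..1}\<close>; the choice of the logarithm is immaterial. Values of \<gamma>
  elsewhere do not enter. For a loop avoiding 0 this is 2 pi i times the winding number about
  0.\<close>

definition log_increment :: "(real \<Rightarrow> complex) \<Rightarrow> complex" where
  "log_increment \<gamma> =
     (THE d. \<exists>g. continuous_on {0..1} g \<and> (\<forall>t\<in>{0..1}. \<gamma> t = exp (g t)) \<and> d = g 1 - g 0)"

lemma log_increment_eq:
  assumes "continuous_on {0..1} g" "\<And>t. t \<in> {0..1} \<Longrightarrow> \<gamma> t = exp (g t)"
  shows "log_increment \<gamma> = g 1 - g 0"
  unfolding log_increment_def
proof (rule the_equality)
  show "\<exists>h. continuous_on {0..1} h \<and> (\<forall>t\<in>{0..1}. \<gamma> t = exp (h t)) \<and> g 1 - g 0 = h 1 - h 0"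
    using assms by blast
  fix d assume "\<exists>h. continuous_on {0..1} h \<and> (\<forall>t\<in>{0..1}. \<gamma> t = exp (h t)) \<and> d = h 1 - h 0"
  then obtain h where "continuous_on {0..1} h" "\<forall>t\<in>{0..1}. \<gamma> t = exp (h t)" "d = h 1 - h 0"
    by blast
  with assms show "d = g 1 - g 0"
    using continuous_log_increment_unique[of "{0..1::real}" h g 0 1] by auto
qed

section \<open>Parametrised edges and triangles, and the increment as a cochain\<close>

definition edge_path :: "real \<Rightarrow> nat \<Rightarrow> real" where
  "edge_path t = (\<lambda>i. if i = 0 then 1 - t else if i = 1 then t else 0)"

text \<open>Points of the standard simplex are sequences of barycentric coordinates padded with
  zeros. Vertex 0 takes the remaining weight, so that the 2-simplex is parametrised by a convex
  planar triangle with legs on the axes.\<close>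

definition triangle_point :: "real \<times> real \<Rightarrow> nat \<Rightarrow> real" where
  "triangle_point p = (\<lambda>i. if i = 0 then 1 - fst p - snd p else if i = 1 then fst p
     else if i = 2 then snd p else 0)"

lemma edge_path_in_simplex: "t \<in> {0..1} \<Longrightarrow> edge_path t \<in> standard_simplex 1"
  by (auto simp: edge_path_def standard_simplex_def)

lemma triangle_point_in_simplex:
  assumes "0 \<le> fst p" "0 \<le> snd p" "fst p + snd p \<le> 1"
  shows "triangle_point p \<in> standard_simplex 2"
  using assms by (auto simp: triangle_point_def standard_simplex_def numeral_2_eq_2)

text \<open>Face k omits vertex k: face 0 is the hypotenuse run from (1, 0) to (0, 1), faces 1 and 2
  are the legs run away from the origin.\<close>

lemma simplical_face_edge_path:
  "simplical_face 0 (edge_path t) = triangle_point (1 - t, t)"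
  "simplical_face 1 (edge_path t) = triangle_point (0, t)"
  "simplical_face 2 (edge_path t) = triangle_point (t, 0)"
  by (auto simp: simplical_face_def edge_path_def triangle_point_def fun_eq_iff)

text \<open>The integer-linear extension of a 1-cochain: a topological form of integrating dz / z
  over the image of the chain under \<open>f\<close>.\<close>

definition chain_log_increment :: "('a \<Rightarrow> complex) \<Rightarrow> 'a chain \<Rightarrow> complex" where
  "chain_log_increment f c =
     (\<Sum>s\<in>Poly_Mapping.keys c. of_int (Poly_Mapping.lookup c s) * log_increment (f \<circ> s \<circ> edge_path))"

lemma chain_log_increment_superset:
  assumes "finite A" "Poly_Mapping.keys c \<subseteq> A"
  shows "chain_log_increment f c =
     (\<Sum>s\<in>A. of_int (Poly_Mapping.lookup c s) * log_increment (f \<circ> s \<circ> edge_path))"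
  unfolding chain_log_increment_def
  by (rule sum.mono_neutral_left) (use assms in \<open>auto simp: in_keys_iff\<close>)

lemma chain_log_increment_add:
  "chain_log_increment f (a + b) = chain_log_increment f a + chain_log_increment f b"
proof -
  let ?A = "Poly_Mapping.keys a \<union> Poly_Mapping.keys b"
  have "chain_log_increment f c =
     (\<Sum>s\<in>?A. of_int (Poly_Mapping.lookup c s) * log_increment (f \<circ> s \<circ> edge_path))"
    if "c \<in> {a, b, a + b}" for c
    by (rule chain_log_increment_superset) (use that keys_add[of a b] in auto)
  then show ?thesis
    by (simp add: lookup_add sum.distrib algebra_simps)
qed

lemma chain_log_increment_minus: "chain_log_increment f (- a) = - chain_log_increment f a"
  by (simp add: chain_log_increment_def sum_negf)

lemma chain_log_increment_diff:
  "chain_log_increment f (a - b) = chain_log_increment f a - chain_log_increment f b"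
  using chain_log_increment_add[of f a "- b"] by (simp add: chain_log_increment_minus)

lemma chain_log_increment_of [simp]:
  "chain_log_increment f (frag_of s) = log_increment (f \<circ> s \<circ> edge_path)"
  by (simp add: chain_log_increment_def)

text \<open>Singular simplices are continuous for the product topology on coordinate sequences.
  Coordinatewise continuity of the parametrisation \<open>e\<close> therefore suffices to return to
  ordinary continuity between normed spaces.\<close>

lemma continuous_on_simplex_comp:
  fixes S :: "'a::real_normed_vector set" and e :: "'b::real_normed_vector \<Rightarrow> nat \<Rightarrow> real"
  assumes s: "singular_simplex p (top_of_set S) s"
    and e: "\<And>t. t \<in> T \<Longrightarrow> e t \<in> standard_simplex p" "\<And>i. continuous_on T (\<lambda>t. e t i)"
  shows "continuous_on T (s \<circ> e)" "t \<in> T \<Longrightarrow> s (e t) \<in> S"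
proof -
  have "continuous_map (top_of_set T) (subtopology (powertop_real UNIV) (standard_simplex p)) e"
    unfolding continuous_map_in_subtopology
    using e by (auto simp: continuous_map_componentwise_UNIV Pi_iff)
  with s have "continuous_map (top_of_set T) (top_of_set S) (s \<circ> e)"
    unfolding singular_simplex_def using continuous_map_compose by blast
  then show "continuous_on T (s \<circ> e)" "t \<in> T \<Longrightarrow> s (e t) \<in> S"
    by (auto simp: continuous_map_in_subtopology Pi_iff)
qed

lemma convex_triangle: "convex {p::real \<times> real. 0 \<le> fst p \<and> 0 \<le> snd p \<and> fst p + snd p \<le> 1}"
proof -
  have "{p::real \<times> real. 0 \<le> fst p \<and> 0 \<le> snd p \<and> fst p + snd p \<le> 1}
      = {p. (1, 0) \<bullet> p \<ge> 0} \<inter> {p. (0, 1) \<bullet> p \<ge> 0} \<inter> {p. (1, 1) \<bullet> p \<le> 1}"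
    by auto
  then show ?thesis by (simp add: convex_Int convex_halfspace_le convex_halfspace_ge)
qed

text \<open>A 2-simplex is contractible, so \<open>f\<close> has a logarithm on it and the increments along the
  three faces telescope.\<close>

lemma chain_log_increment_boundary_simplex:
  fixes S :: "'a::real_normed_vector set"
  assumes f: "continuous_on S f" "\<And>x. x \<in> S \<Longrightarrow> f x \<noteq> 0"
    and s: "singular_simplex 2 (top_of_set S) s"
  shows "chain_log_increment f (chain_boundary 2 (frag_of s)) = 0"
proof -
  define T where "T = {p::real \<times> real. 0 \<le> fst p \<and> 0 \<le> snd p \<and> fst p + snd p \<le> 1}"
  have tri: "triangle_point p \<in> standard_simplex 2" if "p \<in> T" for p
    using that triangle_point_in_simplex unfolding T_def by blast
  have "continuous_on T (\<lambda>p. triangle_point p i)" for i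
    unfolding triangle_point_def
    by (cases "i = 0"; cases "i = 1"; cases "i = 2") (auto intro!: continuous_intros)
  note cont = continuous_on_simplex_comp[where e = triangle_point, OF s tri this]
  have "continuous_on T (f \<circ> (s \<circ> triangle_point))"
    by (rule continuous_on_compose[OF cont(1)]) (use cont in \<open>auto intro: continuous_on_subset[OF f(1)]\<close>)
  then obtain G where G: "continuous_on T G"
      "\<And>p. p \<in> T \<Longrightarrow> (f \<circ> (s \<circ> triangle_point)) p = exp (G p)"
    using continuous_logarithm_on_contractible[of T "f \<circ> (s \<circ> triangle_point)"] cont(2) f(2)
      convex_imp_contractible[OF convex_triangle] unfolding T_def
    by (metis (no_types, lifting) comp_apply)
  have face: "log_increment (f \<circ> singular_face 2 k s \<circ> edge_path) = G (l 1) - G (l 0)"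
    if l: "continuous_on {0..1} l" "\<And>t. t \<in> {0..1} \<Longrightarrow> l t \<in> T"
      "\<And>t. simplical_face k (edge_path t) = triangle_point (l t)" for k l
  proof -
    have "continuous_on {0..1} (G \<circ> l)"
      by (rule continuous_on_compose[OF l(1)]) (use l in \<open>auto intro: continuous_on_subset[OF G(1)]\<close>)
    moreover have "(f \<circ> singular_face 2 k s \<circ> edge_path) t = exp ((G \<circ> l) t)" if "t \<in> {0..1}" for t
      using that l G(2)[of "l t"] edge_path_in_simplex[of t] by (simp add: singular_face_def)
    ultimately show ?thesis using log_increment_eq by fastforce
  qed
  have "log_increment (f \<circ> singular_face 2 0 s \<circ> edge_path) = G (0, 1) - G (1, 0)"
    by (subst face[of "\<lambda>t. (1 - t, t)"]) (auto intro!: continuous_intros simp: T_def simplical_face_edge_path)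
  moreover have "log_increment (f \<circ> singular_face 2 1 s \<circ> edge_path) = G (0, 1) - G (0, 0)"
    by (subst face[of "\<lambda>t. (0, t)"]) (use simplical_face_edge_path in \<open>auto intro!: continuous_intros simp: T_def\<close>)
  moreover have "log_increment (f \<circ> singular_face 2 2 s \<circ> edge_path) = G (1, 0) - G (0, 0)"
    by (subst face[of "\<lambda>t. (t, 0)"]) (auto intro!: continuous_intros simp: T_def simplical_face_edge_path)
  moreover have "chain_boundary 2 (frag_of s) =
      frag_of (singular_face 2 0 s) - frag_of (singular_face 2 1 s) + frag_of (singular_face 2 2 s)"
    by (simp add: chain_boundary_of numeral_2_eq_2)
  ultimately show ?thesis
    by (simp add: chain_log_increment_add chain_log_increment_diff)
qed

lemma chain_log_increment_boundary:
  fixes S :: "'a::real_normed_vector set"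
  assumes f: "continuous_on S f" "\<And>x. x \<in> S \<Longrightarrow> f x \<noteq> 0"
    and d: "singular_chain 2 (top_of_set S) d"
  shows "chain_log_increment f (chain_boundary 2 d) = 0"
proof -
  from d have "Poly_Mapping.keys d \<subseteq> singular_simplex_set 2 (top_of_set S)"
    by (simp add: singular_chain_def)
  then show ?thesis
  proof (induction d rule: frag_induction)
    case zero
    show ?case by (simp add: chain_log_increment_def)
  next
    case (one s)
    with f show ?case using chain_log_increment_boundary_simplex by blast
  next
    case (diff a b)
    then show ?case by (simp add: chain_boundary_diff chain_log_increment_diff)
  qed
qed

section \<open>From vanishing first homology to a global logarithm\<close>

lemma trivial_homology_group_imp_boundary:
  fixes p :: nat
  assumes "trivial_group (homology_group p X)" "singular_relcycle p X {} c"
  shows "singular_relboundary p X {} c"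
proof -
  have mem: "homologous_rel_set p X {} a \<in> carrier (homology_group p X)"
    if "singular_relcycle p X {} a" for a
    using that by (simp add: carrier_relative_homology_group)
  obtain e where e: "carrier (homology_group p X) = {e}"
    using assms(1) by (auto simp: trivial_group_def)
  \<comment> \<open>The carrier is a singleton, so the cycle \<open>c\<close> and the zero chain
    have the same class.\<close>
  have "homologous_rel_set p X {} c = homologous_rel_set p X {} 0"
    using mem[OF assms(2)] mem[OF singular_relcycle_0] unfolding e by simp
  then have "homologous_rel p X {} c 0"
    by (simp only: homologous_rel_set_eq)
  then show ?thesis by (simp add: homologous_rel_def)
qed

text \<open>A loop read as one singular simplex has two equal faces and is a cycle by itself. By
  \<open>H1\<close> it bounds a 2-chain, and increments vanish on boundaries. This takes the place
  of contracting the loop.\<close>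

lemma log_increment_loop_eq_0:
  fixes S :: "'a::real_normed_vector set"
  assumes f: "continuous_on S f" "\<And>x. x \<in> S \<Longrightarrow> f x \<noteq> 0"
    and H1: "trivial_group (homology_group 1 (top_of_set S))"
    and r: "path r" "path_image r \<subseteq> S" "pathfinish r = pathstart r"
  shows "log_increment (f \<circ> r) = 0"
proof -
  \<comment> \<open>The path parameter is the coordinate at vertex 1. The restriction makes
    \<open>s\<close> extensional, as singular simplices have to be.\<close>
  define s where "s = restrict (\<lambda>x. r (x 1)) (standard_simplex 1)"
  have s_edge: "s (edge_path t) = r t" if "t \<in> {0..1}" for t
    using that edge_path_in_simplex[of t] by (simp add: s_def edge_path_def)
  have "continuous_map (powertop_real UNIV) euclideanreal (\<lambda>x. x (1::nat))"
    by (rule continuous_map_product_projection) simp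
  then have "continuous_map (subtopology (powertop_real UNIV) (standard_simplex 1)) (top_of_set {0..1})
      (\<lambda>x. x (1::nat))"
    by (auto simp: continuous_map_in_subtopology continuous_map_from_subtopology standard_simplex_def)
  moreover have "continuous_map (top_of_set {0..1}) (top_of_set S) r"
    using r by (auto simp: path_def path_image_def continuous_map_in_subtopology)
  ultimately have "continuous_map (subtopology (powertop_real UNIV) (standard_simplex 1))
      (top_of_set S) (r \<circ> (\<lambda>x. x 1))"
    by (rule continuous_map_compose)
  then have s: "singular_simplex 1 (top_of_set S) s"
    unfolding singular_simplex_def s_def
    by (auto intro: continuous_map_eq)
  have "singular_face 1 0 s = singular_face 1 1 s"
  proof
    fix x
    have "simplical_face 0 y = edge_path 1 \<and> simplical_face 1 y = edge_path 0"
      if "y \<in> standard_simplex 0" for y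
      using that
      by (auto simp: standard_simplex_0 simplical_face_def edge_path_def fun_eq_iff)
    then show "singular_face 1 0 s x = singular_face 1 1 s x"
      using r(3) s_edge[of 0] s_edge[of 1]
      by (simp add: singular_face_def restrict_def pathstart_def pathfinish_def)
  qed
  then have "chain_boundary 1 (frag_of s) = 0"
    by (simp add: chain_boundary_of)
  with s have "singular_relcycle 1 (top_of_set S) {} (frag_of s)"
    by (simp add: singular_cycle singular_chain_of)
  with H1 have "singular_relboundary 1 (top_of_set S) {} (frag_of s)"
    using trivial_homology_group_imp_boundary[of 1] by simp
  then obtain d where "singular_chain 2 (top_of_set S) d" "chain_boundary 2 d = frag_of s"
    by (auto simp: singular_boundary numeral_2_eq_2)
  then have "log_increment (f \<circ> s \<circ> edge_path) = 0"
    using chain_log_increment_boundary[OF f] by (metis chain_log_increment_of)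
  \<comment> \<open>The two paths are only known to agree on \<open>{0..1}\<close>, which is all
    that \<open>log_increment\<close> looks at.\<close>
  moreover have "log_increment (f \<circ> s \<circ> edge_path) = log_increment (f \<circ> r)"
  proof -
    have "(\<forall>t\<in>{0..1}. (f \<circ> s \<circ> edge_path) t = exp (g t)) \<longleftrightarrow>
        (\<forall>t\<in>{0..1}. (f \<circ> r) t = exp (g t))" for g
      using s_edge by (intro ball_cong) auto
    then show ?thesis unfolding log_increment_def by presburger
  qed
  ultimately show ?thesis by simp
qed

text \<open>\<open>exp\<close> covers the punctured plane, and \<open>f\<close> lifts through it
  once the image of every loop at one base point is homotopic to the image of a closed path
  upstairs. Vanishing increments around loops provide these closed paths, so trivial H_1 can stand
  in for simple connectivity.\<close>

proposition continuous_logarithm_on_trivial_homology: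
  fixes S :: "'a::real_normed_vector set" and f :: "'a \<Rightarrow> complex"
  assumes S: "path_connected S" "locally path_connected S"
    and f: "continuous_on S f" "\<And>x. x \<in> S \<Longrightarrow> f x \<noteq> 0"
    and H1: "trivial_group (homology_group 1 (top_of_set S))"
  obtains g where "continuous_on S g" "\<And>x. x \<in> S \<Longrightarrow> f x = exp (g x)"
proof (cases "S = {}")
  case False
  then obtain z where z: "z \<in> S" by blast
  then have fz: "f z = exp (Ln (f z))" using f(2) by simp
  have lift: "\<exists>q. path q \<and> path_image q \<subseteq> UNIV \<and> pathstart q = Ln (f z) \<and> pathfinish q = Ln (f z) \<and>
      homotopic_paths (- {0}) (f \<circ> r) (exp \<circ> q)"
    if r: "path r" "path_image r \<subseteq> S" "pathstart r = z" "pathfinish r = z" for r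
  proof -
    have fr: "continuous_on {0..1} (f \<circ> r)"
      using r by (intro continuous_on_compose continuous_on_subset[OF f(1)])
        (auto simp: path_def path_image_def)
    moreover have nz: "(f \<circ> r) t \<noteq> 0" if "t \<in> {0..1}" for t
    proof -
      have "r t \<in> S" using that r(2) by (auto simp: path_image_def)
      then show ?thesis using f(2) by simp
    qed
    ultimately obtain h where h: "continuous_on {0..1} h" "\<And>t. t \<in> {0..1} \<Longrightarrow> (f \<circ> r) t = exp (h t)"
      using continuous_logarithm_on_contractible[of "{0..1::real}" "f \<circ> r"]
        convex_imp_contractible[of "{0..1::real}"] by auto
    \<comment> \<open>The logarithm is shifted to start at the chosen lift \<open>Ln (f z)\<close>
      of the base point; its zero increment then closes it up.\<close>
    define q where "q = (\<lambda>t. h t - h 0 + Ln (f z))"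
    have q_exp: "exp (q t) = (f \<circ> r) t" if "t \<in> {0..1}" for t
      using h(2)[OF that] h(2)[of 0] r fz by (simp add: q_def exp_add exp_diff pathstart_def)
    have pq: "path q" unfolding path_def q_def using h(1) by (intro continuous_intros)
    have "h 1 - h 0 = 0"
      using log_increment_eq[OF h] log_increment_loop_eq_0[OF f H1 r(1,2)] r by (simp add: comp_def)
    then have "pathstart q = Ln (f z)" "pathfinish q = Ln (f z)"
      by (auto simp: pathstart_def pathfinish_def q_def)
    moreover have "homotopic_paths (- {0}) (f \<circ> r) (exp \<circ> q)"
    proof (rule homotopic_paths_eq)
      show "path (f \<circ> r)" using fr by (simp add: path_def)
      show "path_image (f \<circ> r) \<subseteq> - {0}" using nz by (auto simp: path_image_def)
    qed (simp add: q_exp)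
    ultimately show ?thesis using pq by blast
  qed
  show ?thesis
    by (rule covering_space_lift_general[OF covering_space_exp_punctured_plane UNIV_I z S f(1) _ fz lift])
      (use f(2) that in \<open>auto simp: Pi_iff\<close>)
qed (use that in auto)

subsection \<open>Gradients and compactly supported fields\<close>

lemma GDERIV_imp_isCont: "GDERIV f x :> D \<Longrightarrow> isCont f x"
  unfolding gderiv_def by (rule has_derivative_continuous)

lemma GDERIV_transform_open:
  assumes "GDERIV f x :> D" "open S" "x \<in> S" "\<And>y. y \<in> S \<Longrightarrow> f y = g y"
  shows "GDERIV g x :> D"
  using assms unfolding gderiv_def by (rule has_derivative_transform_within_open)

lemma C1_onD:
  assumes "C1_on S f"
  shows "x \<in> S \<Longrightarrow> GDERIV f x :> grad f x" "continuous_on S (grad f)"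
  using assms by (auto simp: C1_on_def)

lemma C1_onI:
  fixes f :: "'a::euclidean_space \<Rightarrow> real"
  assumes "\<And>x. x \<in> S \<Longrightarrow> GDERIV f x :> D x" "continuous_on S D"
  shows "C1_on S f"
proof -
  have eq: "grad f x = D x" if "x \<in> S" for x using assms(1)[OF that] by (rule grad_eqI)
  then have "continuous_on S (grad f)" using assms(2) by (simp cong: continuous_on_cong)
  with assms(1) eq show ?thesis by (auto simp: C1_on_def)
qed

lemma C1_on_subset: "C1_on S f \<Longrightarrow> T \<subseteq> S \<Longrightarrow> C1_on T f"
  by (auto simp: C1_on_def intro: continuous_on_subset)

lemma C1_on_imp_continuous_on: "C1_on S f \<Longrightarrow> continuous_on S f"
  by (meson C1_onD(1) GDERIV_imp_isCont continuous_at_imp_continuous_on)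

lemma C1_on_transform_open:
  fixes f :: "'a::euclidean_space \<Rightarrow> real"
  assumes "C1_on S f" "open S" "\<And>y. y \<in> S \<Longrightarrow> f y = g y"
  shows "C1_on S g" "x \<in> S \<Longrightarrow> grad g x = grad f x"
proof -
  have g: "GDERIV g x :> grad f x" if "x \<in> S" for x
    using C1_onD(1)[OF assms(1) that] assms(2) that assms(3) by (rule GDERIV_transform_open)
  then show "C1_on S g" using C1_onD(2)[OF assms(1)] by (rule C1_onI)
  show "x \<in> S \<Longrightarrow> grad g x = grad f x" using g by (intro grad_eqI)
qed

lemma C1_on_Un:
  fixes f :: "'a::euclidean_space \<Rightarrow> real"
  assumes "C1_on S f" "C1_on T f" "open S" "open T"
  shows "C1_on (S \<union> T) f"
  using assms unfolding C1_on_def by (auto intro: continuous_on_open_Un)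

lemma grad_const [simp]: "grad (\<lambda>x. c) x = (0::'a::euclidean_space)"
  by (rule grad_eqI) (rule GDERIV_const)

lemma C1_on_const: "C1_on S (\<lambda>x::'a::euclidean_space. c)"
  by (rule C1_onI[OF GDERIV_const]) simp

lemma grad_mult:
  assumes "C1_on S f" "C1_on S g" "x \<in> S"
  shows "grad (\<lambda>x. f x * g x) x = f x *\<^sub>R grad g x + g x *\<^sub>R grad f x"
  by (intro grad_eqI GDERIV_mult C1_onD(1)[OF assms(1)] C1_onD(1)[OF assms(2)] assms(3))

lemma C1_on_mult:
  fixes f g :: "'a::euclidean_space \<Rightarrow> real"
  assumes "C1_on S f" "C1_on S g"
  shows "C1_on S (\<lambda>x. f x * g x)"
proof (rule C1_onI)
  show "GDERIV (\<lambda>x. f x * g x) x :> f x *\<^sub>R grad g x + g x *\<^sub>R grad f x" if "x \<in> S" for x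
    by (intro GDERIV_mult C1_onD(1)[OF assms(1)] C1_onD(1)[OF assms(2)] that)
  show "continuous_on S (\<lambda>x. f x *\<^sub>R grad g x + g x *\<^sub>R grad f x)"
    by (intro continuous_intros C1_onD(2) assms C1_on_imp_continuous_on)
qed

lemma grad_diff:
  assumes "C1_on S f" "C1_on S g" "x \<in> S"
  shows "grad (\<lambda>x. f x - g x) x = grad f x - grad g x"
  by (intro grad_eqI GDERIV_diff C1_onD(1)[OF assms(1)] C1_onD(1)[OF assms(2)] assms(3))

lemma C1_on_diff:
  fixes f g :: "'a::euclidean_space \<Rightarrow> real"
  assumes "C1_on S f" "C1_on S g"
  shows "C1_on S (\<lambda>x. f x - g x)"
proof (rule C1_onI)
  show "GDERIV (\<lambda>x. f x - g x) x :> grad f x - grad g x" if "x \<in> S" for x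
    by (intro GDERIV_diff C1_onD(1)[OF assms(1)] C1_onD(1)[OF assms(2)] that)
  show "continuous_on S (\<lambda>x. grad f x - grad g x)"
    by (intro continuous_intros C1_onD(2) assms)
qed

lemma grad_compose:
  assumes "C1_on S f" "x \<in> S" "DERIV g (f x) :> d"
  shows "grad (\<lambda>x. g (f x)) x = d *\<^sub>R grad f x"
  by (intro grad_eqI GDERIV_DERIV_compose C1_onD(1)[OF assms(1)] assms(2,3))

lemma C1_on_compose:
  fixes f :: "'a::euclidean_space \<Rightarrow> real"
  assumes f: "C1_on S f" and g: "\<And>t. DERIV g t :> g' t" "continuous_on UNIV g'"
  shows "C1_on S (\<lambda>x. g (f x))"
proof (rule C1_onI)
  show "GDERIV (\<lambda>x. g (f x)) x :> g' (f x) *\<^sub>R grad f x" if "x \<in> S" for x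
    by (intro GDERIV_DERIV_compose C1_onD(1)[OF f] that g)
  have "continuous_on S (\<lambda>x. g' (f x))"
    by (rule continuous_on_compose2[OF g(2) C1_on_imp_continuous_on[OF f]]) simp
  then show "continuous_on S (\<lambda>x. g' (f x) *\<^sub>R grad f x)"
    by (intro continuous_intros C1_onD(2) f)
qed

lemma GDERIV_imp_DERIV_line:
  assumes "GDERIV f x :> D"
  shows "DERIV (\<lambda>t. f (x + t *\<^sub>R e)) 0 :> e \<bullet> D"
proof -
  have "((\<lambda>t. x + t *\<^sub>R e) has_derivative (\<lambda>t. t *\<^sub>R e)) (at (0::real))"
    by (auto intro!: derivative_eq_intros)
  moreover have "(f has_derivative (\<lambda>h. h \<bullet> D)) (at (x + 0 *\<^sub>R e))"
    using assms by (simp add: gderiv_def)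
  ultimately have "((\<lambda>t. f (x + t *\<^sub>R e)) has_derivative (\<lambda>t. t *\<^sub>R e \<bullet> D)) (at 0)"
    by (rule has_derivative_compose)
  moreover have "(\<lambda>t. t *\<^sub>R e \<bullet> D) = (*) (e \<bullet> D)"
    by (auto simp: fun_eq_iff)
  ultimately show ?thesis by (simp add: has_field_derivative_def)
qed

lemma grad_bounded_imp_Lipschitz:
  fixes f :: "'a::euclidean_space \<Rightarrow> real"
  assumes "C1_on UNIV f" "\<And>x. norm (grad f x) \<le> B"
  shows "\<bar>f y - f x\<bar> \<le> B * norm (y - x)"
proof -
  have "norm (f y - f x) \<le> B * norm (y - x)"
  proof (rule differentiable_bound[of UNIV f "\<lambda>x h. h \<bullet> grad f x"])
    show "(f has_derivative (\<lambda>h. h \<bullet> grad f x)) (at x within UNIV)" for x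
      using C1_onD(1)[OF assms(1), of x] by (simp add: gderiv_def)
    show "onorm (\<lambda>h. h \<bullet> grad f x) \<le> B" for x
    proof (rule onorm_le)
      fix h
      have "norm (h \<bullet> grad f x) \<le> norm h * norm (grad f x)"
        using Cauchy_Schwarz_ineq2 by auto
      also have "\<dots> \<le> B * norm h"
        using mult_left_mono[OF assms(2), of "norm h" x] by (simp add: mult.commute)
      finally show "norm (h \<bullet> grad f x) \<le> B * norm h" .
    qed
  qed auto
  then show ?thesis by simp
qed

section \<open>Integration of compactly supported derivatives\<close>

lemma integrable_continuous_compact_support:
  fixes f :: "'a::euclidean_space \<Rightarrow> real"
  assumes "continuous_on UNIV f" "compact K" "\<And>x. x \<notin> K \<Longrightarrow> f x = 0"
  shows "integrable lborel f"
proof -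
  have "integrable lborel (\<lambda>x. indicator K x *\<^sub>R f x)"
    by (rule borel_integrable_compact) (use assms in \<open>auto intro: continuous_on_subset\<close>)
  moreover have "(\<lambda>x. indicator K x *\<^sub>R f x) = f"
    using assms(3) by (auto simp: indicator_def fun_eq_iff)
  ultimately show ?thesis by simp
qed

lemma lborel_translate:
  fixes f :: "'a::euclidean_space \<Rightarrow> real"
  assumes "integrable lborel f"
  shows "integrable lborel (\<lambda>x. f (x + a))" "(LINT x|lborel. f (x + a)) = (LINT x|lborel. f x)"
proof -
  have eq: "lborel = distr lborel borel (\<lambda>x. a + x)"
    by (rule lborel_distr_plus[symmetric])
  from assms have "integrable (distr lborel borel (\<lambda>x. a + x)) f" using eq by simp
  then show "integrable lborel (\<lambda>x. f (x + a))"
    by (subst (asm) integrable_distr_eq) (use assms in \<open>auto simp: add.commute\<close>)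
  have "(LINT x|lborel. f x) = (LINT x|distr lborel borel (\<lambda>x. a + x). f x)" using eq by simp
  also have "\<dots> = (LINT x|lborel. f (a + x))"
    by (rule integral_distr) (use assms in auto)
  finally show "(LINT x|lborel. f (x + a)) = (LINT x|lborel. f x)" by (simp add: add.commute)
qed

lemma grad_eq_0_outside_closed:
  fixes f :: "'a::euclidean_space \<Rightarrow> real"
  assumes "closed K" "\<And>x. x \<notin> K \<Longrightarrow> f x = 0" "x \<notin> K"
  shows "grad f x = 0"
proof (rule grad_eqI)
  show "GDERIV f x :> 0"
    by (rule GDERIV_transform_open[OF GDERIV_const[of 0], of "- K"]) (use assms in auto)
qed

text \<open>The integral of every difference quotient vanishes by translation invariance.\<close>

lemma integral_grad_compact_support:
  fixes f :: "'a::euclidean_space \<Rightarrow> real"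
  assumes f: "C1_on UNIV f" and K: "compact K" "\<And>x. x \<notin> K \<Longrightarrow> f x = 0"
  shows "integrable lborel (\<lambda>x. grad f x \<bullet> e)" "(LINT x|lborel. grad f x \<bullet> e) = 0"
proof -
  have g0: "grad f x = 0" if "x \<notin> K" for x
    using grad_eq_0_outside_closed[of K f] K that compact_imp_closed by blast
  have contf: "continuous_on UNIV f" and contg: "continuous_on UNIV (grad f)"
    using f C1_on_imp_continuous_on C1_onD by auto
  show "integrable lborel (\<lambda>x. grad f x \<bullet> e)"
    by (rule integrable_continuous_compact_support[OF _ K(1)])
      (use contg g0 in \<open>auto intro!: continuous_intros\<close>)
  have "bounded (grad f ` K)"
    using compact_continuous_image[OF continuous_on_subset[OF contg] K(1)] compact_imp_bounded by auto
  then obtain B where B: "B > 0" "\<And>x. x \<in> K \<Longrightarrow> norm (grad f x) \<le> B"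
    by (auto simp: bounded_pos)
  have gB: "norm (grad f x) \<le> B" for x
    using B g0 by (cases "x \<in> K") auto
  have intf: "integrable lborel f"
    by (rule integrable_continuous_compact_support[OF contf K])
  obtain R where R: "K \<subseteq> cball 0 R"
    using compact_imp_bounded[OF K(1)] by (auto simp: bounded_iff subset_iff mem_cball_0)
  define q where "q = (\<lambda>n x. (f (x + inverse (Suc n) *\<^sub>R e) - f x) * real (Suc n))"
  have q0: "(LINT x|lborel. q n x) = 0" for n
    unfolding q_def using lborel_translate[OF intf, of "inverse (Suc n) *\<^sub>R e"] intf by simp
  have "(\<lambda>n. LINT x|lborel. q n x) \<longlonglongrightarrow> (LINT x|lborel. grad f x \<bullet> e)"
  \<comment> \<open>Shifts by at most \<open>norm e\<close> keep all difference quotients supported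
    in the ball of radius \<open>R + norm e\<close>, and the Lipschitz bound \<open>B\<close> of
    \<open>f\<close> bounds them by \<open>B * norm e\<close>.\<close>
  proof (rule integral_dominated_convergence[where w = "\<lambda>x. indicator (cball 0 (R + norm e)) x *\<^sub>R (B * norm e)"])
    have "(\<lambda>x. grad f x \<bullet> e) \<in> borel_measurable borel"
      using contg by (intro borel_measurable_continuous_onI continuous_intros)
    then show "(\<lambda>x. grad f x \<bullet> e) \<in> borel_measurable lborel" by simp
    have "q n \<in> borel_measurable borel" for n
      unfolding q_def
      by (intro borel_measurable_continuous_onI continuous_intros continuous_on_compose2[OF contf]) auto
    then show "q n \<in> borel_measurable lborel" for n by simp
    show "integrable lborel (\<lambda>x. indicator (cball (0::'a) (R + norm e)) x *\<^sub>R (B * norm e))"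
      by (rule borel_integrable_compact) auto
    show "AE x in lborel. (\<lambda>n. q n x) \<longlonglongrightarrow> grad f x \<bullet> e"
    proof (rule AE_I2)
      fix x
      have "((\<lambda>t. (f (x + t *\<^sub>R e) - f x) / t) \<longlongrightarrow> e \<bullet> grad f x) (at 0)"
        using GDERIV_imp_DERIV_line[OF C1_onD(1)[OF f UNIV_I], of x e]
        by (simp add: has_field_derivative_iff)
      moreover have "filterlim (\<lambda>n. inverse (real (Suc n))) (at 0) sequentially"
        unfolding filterlim_at using LIMSEQ_inverse_real_of_nat by simp
      ultimately have "(\<lambda>n. (f (x + inverse (real (Suc n)) *\<^sub>R e) - f x) / inverse (real (Suc n)))
          \<longlonglongrightarrow> e \<bullet> grad f x"
        by (rule filterlim_compose)
      then show "(\<lambda>n. q n x) \<longlonglongrightarrow> grad f x \<bullet> e"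
        by (simp add: q_def inner_commute divide_inverse)
    qed
    show "AE x in lborel. norm (q n x) \<le> indicator (cball 0 (R + norm e)) x *\<^sub>R (B * norm e)" for n
    proof (rule AE_I2)
      fix x
      let ?y = "x + inverse (Suc n) *\<^sub>R e"
      have le: "norm (inverse (Suc n) *\<^sub>R e) \<le> norm e"
      proof -
        have "inverse (real (Suc n)) * norm e \<le> 1 * norm e"
          by (intro mult_right_mono) (auto simp: divide_simps)
        then show ?thesis by simp
      qed
      show "norm (q n x) \<le> indicator (cball 0 (R + norm e)) x *\<^sub>R (B * norm e)"
      proof (cases "x \<in> cball 0 (R + norm e)")
        case True
        have "\<bar>f ?y - f x\<bar> \<le> B * norm (?y - x)"
          using grad_bounded_imp_Lipschitz[OF f gB] .
        then have "\<bar>f ?y - f x\<bar> * real (Suc n) \<le> B * norm (?y - x) * real (Suc n)"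
          by (rule mult_right_mono) simp
        also have "B * norm (?y - x) * real (Suc n) = B * norm e"
          by (simp add: field_simps del: of_nat_Suc)
        finally show ?thesis using True by (simp add: q_def abs_mult del: of_nat_Suc)
      next
        case False
        then have "norm x > R + norm e" by simp
        moreover have "norm ?y \<ge> norm x - norm (inverse (Suc n) *\<^sub>R e)"
          using norm_triangle_ineq2[of x "- (inverse (Suc n) *\<^sub>R e)"] by simp
        moreover have "norm e \<ge> 0" by simp
        ultimately have "norm ?y > R" "norm x > R" using le by linarith+
        then have "?y \<notin> K" "x \<notin> K" using R by (auto simp: subset_iff)
        then show ?thesis using K(2) B(1) by (simp add: q_def)
      qed
    qed
  qed
  then show "(LINT x|lborel. grad f x \<bullet> e) = 0"
    unfolding q0 by (simp add: LIMSEQ_const_iff)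
qed

section \<open>Divergence of C^1 fields\<close>

definition divergence :: "('a::euclidean_space \<Rightarrow> 'a) \<Rightarrow> 'a \<Rightarrow> real" where
  "divergence Y x = (\<Sum>b\<in>Basis. grad (\<lambda>y. Y y \<bullet> b) x \<bullet> b)"

definition C1_field_on :: "'a::euclidean_space set \<Rightarrow> ('a \<Rightarrow> 'a) \<Rightarrow> bool" where
  "C1_field_on S Y \<longleftrightarrow> (\<forall>b\<in>Basis. C1_on S (\<lambda>x. Y x \<bullet> b))"

lemma C1_field_on_imp_continuous_on: "C1_field_on S Y \<Longrightarrow> continuous_on S Y"
  unfolding C1_field_on_def by (subst continuous_on_componentwise) (blast intro: C1_on_imp_continuous_on)

lemma continuous_on_divergence: "C1_field_on S Y \<Longrightarrow> continuous_on S (divergence Y)"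
  unfolding C1_field_on_def divergence_def
  by (auto intro!: continuous_intros C1_onD(2))

lemma C1_field_on_const: "C1_field_on S (\<lambda>x. c)"
  by (simp add: C1_field_on_def C1_on_const)

lemma divergence_const [simp]: "divergence (\<lambda>x. c) x = 0"
  by (simp add: divergence_def)

lemma C1_field_on_scaleR: "C1_on S h \<Longrightarrow> C1_field_on S Y \<Longrightarrow> C1_field_on S (\<lambda>x. h x *\<^sub>R Y x)"
  by (simp add: C1_field_on_def C1_on_mult)

lemma divergence_scaleR:
  assumes "C1_on S h" "C1_field_on S Y" "x \<in> S"
  shows "divergence (\<lambda>x. h x *\<^sub>R Y x) x = h x * divergence Y x + Y x \<bullet> grad h x"
proof -
  have "grad (\<lambda>y. (h y *\<^sub>R Y y) \<bullet> b) x \<bullet> b =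
      h x * (grad (\<lambda>y. Y y \<bullet> b) x \<bullet> b) + (Y x \<bullet> b) * (grad h x \<bullet> b)" if "b \<in> Basis" for b
    using assms that by (simp add: C1_field_on_def grad_mult[of S h "\<lambda>y. Y y \<bullet> b"] inner_simps)
  then show ?thesis
    by (simp add: divergence_def sum.distrib sum_distrib_left euclidean_inner[of "Y x" "grad h x"])
qed

text \<open>Extended by zero, each component of \<xi> Y is C^1 on \<Omega> and on the complement of
  \<open>K\<close>, hence on the whole space. The integrand is div(\<xi> Y), a sum of partial
  derivatives whose integrals vanish.\<close>

lemma integral_divergence_compact_support:
  fixes Y :: "'a::euclidean_space \<Rightarrow> 'a"
  assumes \<Omega>: "open \<Omega>" and Y: "C1_field_on \<Omega> Y" and \<xi>: "C1_on \<Omega> \<xi>"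
    and K: "compact K" "K \<subseteq> \<Omega>" "\<And>x. x \<in> \<Omega> - K \<Longrightarrow> \<xi> x = 0"
  shows "set_integrable lborel \<Omega> (\<lambda>x. \<xi> x * divergence Y x + Y x \<bullet> grad \<xi> x)"
    "(LINT x:\<Omega>|lborel. \<xi> x * divergence Y x + Y x \<bullet> grad \<xi> x) = 0"
proof -
  define F where "F = (\<lambda>b x. if x \<in> \<Omega> then \<xi> x * (Y x \<bullet> b) else 0)"
  have off: "F b x = 0" if "x \<notin> K" for b x
    using that K(3) by (auto simp: F_def)
  have on: "C1_on \<Omega> (\<lambda>x. \<xi> x * (Y x \<bullet> b))" if "b \<in> Basis" for b
    using Y \<xi> that by (auto simp: C1_field_on_def intro: C1_on_mult)
  note F\<Omega> = C1_on_transform_open[OF on \<Omega>, of _ "F _"]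
  have "C1_on UNIV (F b)" if b: "b \<in> Basis" for b
  proof -
    have "C1_on \<Omega> (F b)" using F\<Omega>(1)[OF b] by (simp add: F_def)
    moreover have "C1_on (- K) (F b)"
      by (rule C1_on_transform_open(1)[OF C1_on_const[where c = 0]])
        (use off K(1) compact_imp_closed in auto)
    ultimately have "C1_on (\<Omega> \<union> - K) (F b)"
      using \<Omega> K(1) compact_imp_closed by (intro C1_on_Un) auto
    then show ?thesis by (rule C1_on_subset) (use K(2) in auto)
  qed
  then have int: "integrable lborel (\<lambda>x. grad (F b) x \<bullet> b)" "(LINT x|lborel. grad (F b) x \<bullet> b) = 0"
    if "b \<in> Basis" for b
    using integral_grad_compact_support[of "F b" K] K(1) off that by blast+
  have eq: "indicator \<Omega> x *\<^sub>R (\<xi> x * divergence Y x + Y x \<bullet> grad \<xi> x) = (\<Sum>b\<in>Basis. grad (F b) x \<bullet> b)"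
    for x
  proof (cases "x \<in> \<Omega>")
    case True
    have "grad (F b) x = \<xi> x *\<^sub>R grad (\<lambda>y. Y y \<bullet> b) x + (Y x \<bullet> b) *\<^sub>R grad \<xi> x" if b: "b \<in> Basis" for b
      using F\<Omega>(2)[OF b _ True, of b] Y \<xi> b True
      by (simp add: F_def grad_mult[of \<Omega>] C1_field_on_def)
    with True show ?thesis
      by (simp add: divergence_def inner_simps sum.distrib sum_distrib_left euclidean_inner[of "Y x" "grad \<xi> x"])
  next
    case False
    then have "grad (F b) x = 0" for b
      using grad_eq_0_outside_closed[of K "F b"] K off compact_imp_closed by blast
    with False show ?thesis by simp
  qed
  show "set_integrable lborel \<Omega> (\<lambda>x. \<xi> x * divergence Y x + Y x \<bullet> grad \<xi> x)"
    unfolding set_integrable_def eq by (intro Bochner_Integration.integrable_sum int)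
  show "(LINT x:\<Omega>|lborel. \<xi> x * divergence Y x + Y x \<bullet> grad \<xi> x) = 0"
    unfolding set_lebesgue_integral_def eq by (subst Bochner_Integration.integral_sum) (simp_all add: int)
qed

subsection \<open>Cutoff functions\<close>

text \<open>A piecewise quadratic C^1 transition from 0 to 1. Its derivative is the tent over [0, 1]
  with peak 2 at 1/2, so of area 1; the coefficients 2, -4, 2 are half the slope changes 4, -8, 4 of
  that tent.\<close>

definition smoothstep :: "real \<Rightarrow> real" where
  "smoothstep t = 2 * (max 0 t)\<^sup>2 - 4 * (max 0 (t - 1/2))\<^sup>2 + 2 * (max 0 (t - 1))\<^sup>2"

definition smoothstep' :: "real \<Rightarrow> real" where
  "smoothstep' t = 4 * max 0 t - 8 * max 0 (t - 1/2) + 4 * max 0 (t - 1)"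

lemma DERIV_max_0_square: "DERIV (\<lambda>t::real. (max 0 t)\<^sup>2) t :> 2 * max 0 t"
proof -
  consider "t < 0" | "t > 0" | "t = 0" by linarith
  then show ?thesis
  proof cases
    case 1
    have "DERIV (\<lambda>t::real. 0) t :> 2 * max 0 t" using 1 by (auto intro!: derivative_eq_intros)
    then show ?thesis
      by (rule has_field_derivative_transform_within_open[of _ _ _ "{..<0}"]) (use 1 in auto)
  next
    case 2
    have "DERIV (\<lambda>t::real. t\<^sup>2) t :> 2 * max 0 t" using 2 by (auto intro!: derivative_eq_intros)
    then show ?thesis
      by (rule has_field_derivative_transform_within_open[of _ _ _ "{0<..}"]) (use 2 in auto)
  next
    case 3
    have "((\<lambda>h::real. max 0 h) \<longlongrightarrow> max 0 0) (at 0)"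
      by (intro tendsto_intros)
    moreover have "max 0 h = ((max 0 (0 + h))\<^sup>2 - (max 0 0)\<^sup>2) / h" if "h \<noteq> 0" for h :: real
      using that by (auto simp: max_def power2_eq_square)
    ultimately have "((\<lambda>h::real. ((max 0 (0 + h))\<^sup>2 - (max 0 0)\<^sup>2) / h) \<longlongrightarrow> max 0 0) (at 0)"
      by (rule Lim_transform_eventually[OF _ eventually_mono[OF eventually_neq_at_within]])
    with 3 show ?thesis by (simp add: DERIV_def)
  qed
qed

lemma DERIV_smoothstep: "DERIV smoothstep t :> smoothstep' t"
proof -
  have shift: "DERIV (\<lambda>t::real. (max 0 (t - c))\<^sup>2) t :> 2 * max 0 (t - c)" for c
  proof -
    have "DERIV (\<lambda>t. t - c) t :> 1" by (auto intro!: derivative_eq_intros)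
    from DERIV_chain2[where f = "\<lambda>t. (max 0 t)\<^sup>2", OF DERIV_max_0_square this]
    show ?thesis by simp
  qed
  show ?thesis unfolding smoothstep_def smoothstep'_def
    by (rule derivative_eq_intros DERIV_max_0_square shift refl)+ simp
qed

lemma continuous_on_smoothstep': "continuous_on S smoothstep'"
  unfolding smoothstep'_def by (intro continuous_intros)

lemma smoothstep'_nonneg: "0 \<le> smoothstep' t" and smoothstep'_le: "smoothstep' t \<le> 2"
  by (auto simp: smoothstep'_def max_def)

lemma smoothstep'_eq_0: "t \<le> 0 \<or> 1 \<le> t \<Longrightarrow> smoothstep' t = 0"
  by (auto simp: smoothstep'_def max_def)

lemma smoothstep_eq_0: "t \<le> 0 \<Longrightarrow> smoothstep t = 0"
  by (auto simp: smoothstep_def max_def)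

lemma smoothstep_eq_1: "1 \<le> t \<Longrightarrow> smoothstep t = 1"
  by (auto simp: smoothstep_def max_def power2_eq_square algebra_simps)

lemma smoothstep_mono: "s \<le> t \<Longrightarrow> smoothstep s \<le> smoothstep t"
  by (rule DERIV_nonneg_imp_nondecreasing) (use DERIV_smoothstep smoothstep'_nonneg in blast)+

lemma smoothstep_bounds: "0 \<le> smoothstep t" "smoothstep t \<le> 1"
  using smoothstep_mono[of "min t 0" t] smoothstep_mono[of t "max t 1"]
  by (auto simp: smoothstep_eq_0 smoothstep_eq_1)

text \<open>The squared distance keeps the function differentiable at the centre. The factor 4 / (3
  r^2) is chosen so that the argument of \<open>smoothstep\<close> is 0 at distance r and 1 at
  distance r / 2.\<close>

definition bump :: "'a::euclidean_space \<Rightarrow> real \<Rightarrow> 'a \<Rightarrow> real" where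
  "bump x r y = smoothstep ((r\<^sup>2 - (dist x y)\<^sup>2) * (4 / (3 * r\<^sup>2)))"

lemma GDERIV_bump:
  "GDERIV (bump x r) y :>
     smoothstep' ((r\<^sup>2 - (dist x y)\<^sup>2) * (4 / (3 * r\<^sup>2))) *\<^sub>R (- (8 / (3 * r\<^sup>2)) *\<^sub>R (y - x))"
proof -
  have "GDERIV (\<lambda>y. (r\<^sup>2 - (dist x y)\<^sup>2) * c) y :> - (2 * c) *\<^sub>R (y - x)" for c
    unfolding gderiv_def dist_norm power2_norm_eq_inner
    by (rule derivative_eq_intros refl)+ (simp add: fun_eq_iff inner_commute algebra_simps)
  from this[of "4 / (3 * r\<^sup>2)"]
  have "GDERIV (\<lambda>y. (r\<^sup>2 - (dist x y)\<^sup>2) * (4 / (3 * r\<^sup>2))) y :> - (8 / (3 * r\<^sup>2)) *\<^sub>R (y - x)"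
    by simp
  then show ?thesis
    unfolding bump_def by (rule GDERIV_DERIV_compose[OF _ DERIV_smoothstep])
qed

lemma C1_on_bump: "C1_on S (bump x r)"
  by (rule C1_onI[OF GDERIV_bump])
    (intro continuous_intros continuous_on_compose2[OF continuous_on_smoothstep'[of UNIV]], auto)

lemma bump_bounds: "0 \<le> bump x r y" "bump x r y \<le> 1"
  by (simp_all add: bump_def smoothstep_bounds)

lemma bump_eq_0: "r \<le> dist x y \<Longrightarrow> 0 < r \<Longrightarrow> bump x r y = 0"
  unfolding bump_def by (intro smoothstep_eq_0 mult_nonpos_nonneg) (auto intro: power_mono)

lemma bump_eq_1: "dist x y \<le> r / 2 \<Longrightarrow> 0 < r \<Longrightarrow> bump x r y = 1"
proof -
  assume "dist x y \<le> r / 2" "0 < r"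
  moreover from this have "(dist x y)\<^sup>2 \<le> (r / 2)\<^sup>2" by (intro power_mono) auto
  ultimately show "bump x r y = 1"
    unfolding bump_def by (intro smoothstep_eq_1) (simp add: field_simps power2_eq_square)
qed

lemma grad_bump_eq_0:
  assumes "r \<le> dist x y" "0 < r"
  shows "grad (bump x r) y = 0"
proof -
  have "smoothstep' ((r\<^sup>2 - (dist x y)\<^sup>2) * (4 / (3 * r\<^sup>2))) = 0"
    using assms by (intro smoothstep'_eq_0 disjI1 mult_nonpos_nonneg) (auto intro: power_mono)
  then show ?thesis unfolding grad_eqI[OF GDERIV_bump] by simp
qed

lemma norm_grad_bump_le:
  assumes "0 < r"
  shows "norm (grad (bump x r) y) \<le> 6 / r"
proof (cases "r \<le> dist x y")
  case True
  with assms show ?thesis by (simp add: grad_bump_eq_0)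
next
  case False
  let ?s = "smoothstep' ((r\<^sup>2 - (dist x y)\<^sup>2) * (4 / (3 * r\<^sup>2)))"
  have "norm (grad (bump x r) y) = ?s * (8 / (3 * r\<^sup>2) * dist x y)"
    unfolding grad_eqI[OF GDERIV_bump] using smoothstep'_nonneg by (simp add: dist_norm norm_minus_commute)
  also have "\<dots> \<le> 2 * (8 / (3 * r\<^sup>2) * r)"
    using False smoothstep'_nonneg smoothstep'_le by (intro mult_mono) auto
  \<comment> \<open>The exact constant is 16/3, rounded up.\<close>
  also have "\<dots> \<le> 6 / r" using assms by (simp add: field_simps power2_eq_square)
  finally show ?thesis .
qed

text \<open>Volume packing: the balls of radius d / 2 around the points of \<open>F\<close> are
  disjoint and lie in the ball of radius R + d / 2.\<close>

lemma card_separated_le: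
  fixes F :: "'a::euclidean_space set"
  assumes F: "finite F" "F \<subseteq> cball y R" "\<And>u v. u \<in> F \<Longrightarrow> v \<in> F \<Longrightarrow> u \<noteq> v \<Longrightarrow> d \<le> dist u v"
    and "0 < d" "0 \<le> R"
  shows "real (card F) \<le> ((2 * R + d) / d) ^ DIM('a)"
proof -
  let ?V = "unit_ball_vol (real DIM('a))"
  have fm: "ball u s \<in> fmeasurable lborel" for u :: 'a and s
    using emeasure_bounded_finite[OF bounded_ball, of u s] by (simp add: fmeasurable_def)
  have "real (card F) * (?V * (d / 2) ^ DIM('a)) = (\<Sum>u\<in>F. measure lborel (ball u (d / 2)))"
    using \<open>0 < d\<close> by (simp add: content_ball)
  also have "\<dots> = measure lborel (\<Union>u\<in>F. ball u (d / 2))"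
  proof (rule measure_UNION'[symmetric])
    show "pairwise (\<lambda>u v. disjnt (ball u (d / 2)) (ball v (d / 2))) F"
    proof (rule pairwiseI)
      fix u v assume "u \<in> F" "v \<in> F" "u \<noteq> v"
      then have "d \<le> dist u v" using F by blast
      then show "disjnt (ball u (d / 2)) (ball v (d / 2))"
      proof (unfold disjnt_iff, safe)
        fix z assume "z \<in> ball u (d / 2)" "z \<in> ball v (d / 2)"
        then have "dist u v < d"
          using dist_triangle_half_r[of z u d v] by (simp add: dist_commute)
        with \<open>d \<le> dist u v\<close> show False by simp
      qed
    qed
  qed (use F fm in auto)
  also have "\<dots> \<le> measure lborel (ball y (R + d / 2))"
  proof (rule measure_mono_fmeasurable)
    show "(\<Union>u\<in>F. ball u (d / 2)) \<subseteq> ball y (R + d / 2)"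
    proof clarsimp
      fix u z assume "u \<in> F" "dist u z * 2 < d"
      moreover have "dist y u \<le> R" using F \<open>u \<in> F\<close> by auto
      ultimately show "dist y z < R + d / 2" using dist_triangle[of y z u] by linarith
    qed
  qed (use F(1) fm in auto)
  also have "\<dots> = ?V * (R + d / 2) ^ DIM('a)"
    using assms by (simp add: content_ball)
  finally have "?V * (real (card F) * (d / 2) ^ DIM('a)) \<le> ?V * (R + d / 2) ^ DIM('a)"
    by (simp add: mult_ac)
  then have "real (card F) * (d / 2) ^ DIM('a) \<le> (R + d / 2) ^ DIM('a)"
    by (simp add: mult_le_cancel_left)
  then have "real (card F) \<le> (R + d / 2) ^ DIM('a) / (d / 2) ^ DIM('a)"
    using \<open>0 < d\<close> by (simp add: pos_le_divide_eq)
  also have "\<dots> = ((2 * R + d) / d) ^ DIM('a)"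
  proof -
    have "(R + d / 2) / (d / 2) = (2 * R + d) / d" using \<open>0 < d\<close> by (simp add: field_simps)
    then show ?thesis by (simp only: power_divide[symmetric])
  qed
  finally show ?thesis .
qed

text \<open>The packing bound makes a separated subset of largest cardinality exist; a point of
  \<open>S\<close> at distance at least d from all of it could be added.\<close>

lemma maximal_separated_subset:
  fixes S :: "'a::euclidean_space set"
  assumes "bounded S" "0 < d"
  obtains F where "finite F" "F \<subseteq> S" "\<And>u v. u \<in> F \<Longrightarrow> v \<in> F \<Longrightarrow> u \<noteq> v \<Longrightarrow> d \<le> dist u v"
    "\<And>x. x \<in> S \<Longrightarrow> \<exists>u\<in>F. dist u x < d"
proof -
  let ?P = "\<lambda>F. finite F \<and> F \<subseteq> S \<and> (\<forall>u\<in>F. \<forall>v\<in>F. u \<noteq> v \<longrightarrow> d \<le> dist u v)"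
  obtain R where R: "0 \<le> R" "S \<subseteq> cball 0 R"
    using \<open>bounded S\<close> unfolding bounded_pos by (metis less_imp_le mem_cball_0 subsetI)
  have "card F < Suc (nat \<lceil>((2 * R + d) / d) ^ DIM('a)\<rceil>)" if "?P F" for F
  proof -
    have "F \<subseteq> cball 0 R" using that R by blast
    then have "real (card F) \<le> ((2 * R + d) / d) ^ DIM('a)"
      using card_separated_le[of F 0 R d] that R assms by blast
    then show ?thesis by linarith
  qed
  then have "\<exists>F. ?P F \<and> (\<forall>F'. ?P F' \<longrightarrow> card F' \<le> card F)"
    by (intro ex_has_greatest_nat[of ?P "{}"]) auto
  then obtain F where F: "?P F" "\<And>F'. ?P F' \<Longrightarrow> card F' \<le> card F"
    by (elim exE conjE) simp
  have "\<exists>u\<in>F. dist u x < d" if "x \<in> S" for x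
  proof (rule ccontr)
    assume "\<not> (\<exists>u\<in>F. dist u x < d)"
    then have far: "\<And>u. u \<in> F \<Longrightarrow> d \<le> dist u x" by force
    then have "x \<notin> F" using \<open>0 < d\<close> by force
    have "?P (insert x F)" using F(1) \<open>x \<in> S\<close> far by (auto simp: dist_commute)
    then have "card (insert x F) \<le> card F" by (rule F(2))
    then show False using \<open>x \<notin> F\<close> F(1) by simp
  qed
  with F(1) show ?thesis using that by blast
qed

lemma prod_bump_complement:
  fixes F :: "'a::euclidean_space set"
  assumes "finite F"
  shows "C1_on UNIV (\<lambda>y. \<Prod>x\<in>F. 1 - bump x r y) \<and>
    norm (grad (\<lambda>y. \<Prod>x\<in>F. 1 - bump x r y) y) \<le> (\<Sum>x\<in>F. norm (grad (bump x r) y))"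
  using assms
proof (induction F rule: finite_induct)
  case empty
  show ?case by (simp add: C1_on_const)
next
  case (insert a F)
  let ?p = "\<lambda>y. \<Prod>x\<in>F. 1 - bump x r y" and ?q = "\<lambda>y. 1 - bump a r y"
  have q: "C1_on UNIV ?q" "grad ?q y = - grad (bump a r) y"
    using C1_on_diff[OF C1_on_const C1_on_bump] grad_diff[OF C1_on_const C1_on_bump, of y UNIV] by auto
  have p: "C1_on UNIV ?p" using insert by blast
  have p01: "0 \<le> ?p y" "?p y \<le> 1"
    using bump_bounds by (auto intro!: prod_nonneg prod_le_1 simp: algebra_simps)
  have "grad (\<lambda>y. ?q y * ?p y) y = ?q y *\<^sub>R grad ?p y - ?p y *\<^sub>R grad (bump a r) y"
    using grad_mult[OF q(1) p UNIV_I] by (simp add: q(2))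
  also have "norm \<dots> \<le> ?q y * norm (grad ?p y) + ?p y * norm (grad (bump a r) y)"
    using p01 bump_bounds[of a r y] by (intro order_trans[OF norm_triangle_ineq4]) simp
  also have "\<dots> \<le> 1 * norm (grad ?p y) + 1 * norm (grad (bump a r) y)"
    using p01 bump_bounds[of a r y] by (intro add_mono mult_right_mono) auto
  finally show ?case
    using insert C1_on_mult[OF q(1) p] by auto
qed

text \<open>The factor \<open>9 ^ DIM('a)\<close> bounds the number of points of an \<open>r / 4\<close>-separated set
  in a ball of radius \<open>r\<close>.\<close>

lemma cutoff_near_bounded_set:
  fixes S :: "'a::euclidean_space set"
  assumes "bounded S" "0 < r"
  obtains \<eta> where "C1_on UNIV \<eta>" "\<And>y. 0 \<le> \<eta> y" "\<And>y. \<eta> y \<le> 1"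
    "\<And>x y. x \<in> S \<Longrightarrow> dist x y < r / 4 \<Longrightarrow> \<eta> y = 0"
    "\<And>y. y \<notin> (\<Union>x\<in>S. ball x r) \<Longrightarrow> \<eta> y = 1 \<and> grad \<eta> y = 0"
    "\<And>y. norm (grad \<eta> y) \<le> 9 ^ DIM('a) * (6 / r)"
proof -
  obtain F where F: "finite F" "F \<subseteq> S" "\<And>u v. u \<in> F \<Longrightarrow> v \<in> F \<Longrightarrow> u \<noteq> v \<Longrightarrow> r / 4 \<le> dist u v"
    "\<And>x. x \<in> S \<Longrightarrow> \<exists>u\<in>F. dist u x < r / 4"
    using maximal_separated_subset[OF assms(1), of "r / 4"] assms(2) by (metis zero_less_divide_iff zero_less_numeral)
  define \<eta> where "\<eta> = (\<lambda>y. \<Prod>x\<in>F. 1 - bump x r y)"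
  have \<eta>: "C1_on UNIV \<eta>" "norm (grad \<eta> y) \<le> (\<Sum>x\<in>F. norm (grad (bump x r) y))" for y
    using prod_bump_complement[OF F(1)] unfolding \<eta>_def by blast+
  show ?thesis
  proof (rule that[OF \<eta>(1)])
    show "0 \<le> \<eta> y" "\<eta> y \<le> 1" for y
      unfolding \<eta>_def using bump_bounds by (auto intro!: prod_nonneg prod_le_1 simp: algebra_simps)
    show "\<eta> y = 0" if x: "x \<in> S" "dist x y < r / 4" for x y
    proof -
      obtain u where u: "u \<in> F" "dist u x < r / 4" using F(4) x by blast
      \<comment> \<open>One r / 4 comes from the density of \<open>F\<close> in \<open>S\<close>,
        the other from the distance of y to \<open>S\<close>; together they stay in the half ball
        where the bump is 1.\<close>
      then have "dist u y \<le> r / 2" using x dist_triangle[of u y x] by linarith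
      then have "bump u r y = 1" using assms by (intro bump_eq_1)
      then show ?thesis unfolding \<eta>_def using F(1) u by (intro prod_zero) auto
    qed
    show "\<eta> y = 1 \<and> grad \<eta> y = 0" if "y \<notin> (\<Union>x\<in>S. ball x r)" for y
    proof -
      have "r \<le> dist x y" if "x \<in> F" for x
        using that \<open>y \<notin> _\<close> F(2) by force
      then have "bump x r y = 0 \<and> grad (bump x r) y = 0" if "x \<in> F" for x
        using that assms by (simp add: bump_eq_0 grad_bump_eq_0)
      then show ?thesis using \<eta>(2)[of y] by (simp add: \<eta>_def)
    qed
    show "norm (grad \<eta> y) \<le> 9 ^ DIM('a) * (6 / r)" for y
    proof -
      let ?F = "{x \<in> F. dist x y < r}"
      have "(\<Sum>x\<in>F. norm (grad (bump x r) y)) = (\<Sum>x\<in>?F. norm (grad (bump x r) y))"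
        using F(1) assms
        by (intro sum.mono_neutral_right) (auto simp: not_less[symmetric] intro: grad_bump_eq_0)
      also have "\<dots> \<le> real (card ?F) * (6 / r)"
        by (rule sum_bounded_above) (rule norm_grad_bump_le[OF assms(2)])
      also have "\<dots> \<le> ((2 * r + r / 4) / (r / 4)) ^ DIM('a) * (6 / r)"
      proof (rule mult_right_mono)
        show "real (card ?F) \<le> ((2 * r + r / 4) / (r / 4)) ^ DIM('a)"
        proof (rule card_separated_le)
          show "?F \<subseteq> cball y r" by (auto simp: dist_commute)
          show "r / 4 \<le> dist u v" if "u \<in> ?F" "v \<in> ?F" "u \<noteq> v" for u v
            using that F(3) by blast
        qed (use F(1) assms in auto)
      qed (use assms in simp)
      also have "(2 * r + r / 4) / (r / 4) = 9" using assms by (simp add: field_simps)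
      finally show ?thesis using \<eta>(2)[of y] by linarith
    qed
  qed
qed

subsection \<open>The divergence theorem for tangential fields\<close>

lemma set_integrable_continuous_bound:
  fixes f g :: "'a::euclidean_space \<Rightarrow> real"
  assumes "open \<Omega>" "continuous_on \<Omega> g" "set_integrable lborel \<Omega> f"
    "\<And>x. x \<in> \<Omega> \<Longrightarrow> \<bar>g x\<bar> \<le> \<bar>f x\<bar>"
  shows "set_integrable lborel \<Omega> g"
proof (rule set_integrable_bound[OF assms(3)])
  have "(\<lambda>x. indicator \<Omega> x *\<^sub>R g x) \<in> borel_measurable borel"
    using assms by (intro borel_measurable_continuous_on_indicator) auto
  then show "set_borel_measurable lborel \<Omega> g"
    by (simp add: set_borel_measurable_def)
qed (use assms(4) in auto)

lemma set_integrable_bounded_continuous: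
  fixes g :: "'a::euclidean_space \<Rightarrow> real"
  assumes "open \<Omega>" "bounded \<Omega>" "continuous_on \<Omega> g" "\<And>x. x \<in> \<Omega> \<Longrightarrow> \<bar>g x\<bar> \<le> B"
  shows "set_integrable lborel \<Omega> g"
proof (rule set_integrable_continuous_bound[OF assms(1,3)])
  show "set_integrable lborel \<Omega> (\<lambda>x. B)"
    using assms(1,2) emeasure_bounded_finite[OF assms(2)] by (simp add: set_integrable_def)
  show "\<bar>g x\<bar> \<le> \<bar>B\<bar>" if "x \<in> \<Omega>" for x using assms(4)[OF that] by simp
qed

lemma continuous_on_UNIV_bounded_on:
  fixes f :: "'a::euclidean_space \<Rightarrow> 'b::real_normed_vector"
  assumes "continuous_on UNIV f" "bounded S"
  obtains B where "0 < B" "\<And>x. x \<in> S \<Longrightarrow> norm (f x) \<le> B"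
proof -
  have "compact (closure S)" using assms(2) by simp
  then have "bounded (f ` closure S)"
    using assms(1) by (intro compact_imp_bounded compact_continuous_image) (auto intro: continuous_on_subset)
  then obtain B where "0 < B" "\<forall>y\<in>f ` closure S. norm y \<le> B" by (auto simp: bounded_pos)
  then show ?thesis using that closure_subset by (metis imageI subsetD)
qed

lemma GDERIV_nonzero_imp_not_local_min:
  fixes f :: "'a::euclidean_space \<Rightarrow> real"
  assumes "GDERIV f x :> D" "D \<noteq> 0" "open S" "x \<in> S"
  shows "\<exists>y\<in>S. f y < f x"
proof (rule ccontr)
  assume "\<not> ?thesis"
  then have "\<forall>y\<in>S. f x \<le> f y" by force
  with assms have "(\<lambda>h. h \<bullet> D) = (\<lambda>h. 0)"
    unfolding gderiv_def by (intro differential_zero_maxmin[of x S f]) auto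
  then have "D \<bullet> D = 0" by meson
  with \<open>D \<noteq> 0\<close> show False by simp
qed

text \<open>The bound by \<open>G\<close> instead of an equality admits fields \<open>h x *\<^sub>R X x\<close> with \<open>h\<close> bounded
  but without boundary values.\<close>

definition tangential_at_boundary :: "'a::euclidean_space set \<Rightarrow> ('a \<Rightarrow> 'a) \<Rightarrow> bool" where
  "tangential_at_boundary \<Omega> Y \<longleftrightarrow>
     (\<exists>G. continuous_on (\<Omega> \<union> regular_boundary \<Omega>) G \<and>
          (\<forall>x \<nu>. outward_unit_normal \<Omega> x \<nu> \<longrightarrow> G x \<bullet> \<nu> = 0) \<and>
          (\<forall>x\<in>\<Omega>. \<forall>v. \<bar>Y x \<bullet> v\<bar> \<le> \<bar>G x \<bullet> v\<bar>))"

text \<open>By the product rule the integrand is div(\<zeta> Y), so the value stands for the flux of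
  \<zeta> Y through the boundary, expressed without a boundary integral.\<close>

definition weak_divergence :: "'a::euclidean_space set \<Rightarrow> ('a \<Rightarrow> 'a) \<Rightarrow> ('a \<Rightarrow> real) \<Rightarrow> real" where
  "weak_divergence \<Omega> Y \<zeta> = (LINT x:\<Omega>|lborel. \<zeta> x * divergence Y x + Y x \<bullet> grad \<zeta> x)"

lemma set_integrable_weak_divergence:
  fixes Y :: "'a::euclidean_space \<Rightarrow> 'a"
  assumes \<Omega>: "open \<Omega>" "bounded \<Omega>" and Y: "C1_field_on \<Omega> Y"
    "set_integrable lborel \<Omega> (divergence Y)" "set_integrable lborel \<Omega> (\<lambda>x. norm (Y x))"
    and \<zeta>: "C1_on UNIV \<zeta>"
  shows "set_integrable lborel \<Omega> (\<lambda>x. \<zeta> x * divergence Y x)"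
    "set_integrable lborel \<Omega> (\<lambda>x. Y x \<bullet> grad \<zeta> x)"
    "set_integrable lborel \<Omega> (\<lambda>x. \<zeta> x * divergence Y x + Y x \<bullet> grad \<zeta> x)"
proof -
  obtain A where A: "0 < A" "\<And>x. x \<in> \<Omega> \<Longrightarrow> norm (\<zeta> x) \<le> A"
    using continuous_on_UNIV_bounded_on[OF C1_on_imp_continuous_on[OF \<zeta>] \<Omega>(2)] by blast
  obtain B where B: "0 < B" "\<And>x. x \<in> \<Omega> \<Longrightarrow> norm (grad \<zeta> x) \<le> B"
    using continuous_on_UNIV_bounded_on[OF C1_onD(2)[OF \<zeta>] \<Omega>(2)] by blast
  note cont = C1_field_on_imp_continuous_on[OF Y(1)] continuous_on_divergence[OF Y(1)]
    continuous_on_subset[OF C1_on_imp_continuous_on[OF \<zeta>] subset_UNIV]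
    continuous_on_subset[OF C1_onD(2)[OF \<zeta>] subset_UNIV]
  show 1: "set_integrable lborel \<Omega> (\<lambda>x. \<zeta> x * divergence Y x)"
  proof (rule set_integrable_continuous_bound[OF \<Omega>(1)])
    show "set_integrable lborel \<Omega> (\<lambda>x. A * divergence Y x)" using Y(2) by simp
    show "\<bar>\<zeta> x * divergence Y x\<bar> \<le> \<bar>A * divergence Y x\<bar>" if "x \<in> \<Omega>" for x
      using A that by (auto simp: abs_mult intro!: mult_right_mono)
  qed (intro continuous_intros cont)
  show 2: "set_integrable lborel \<Omega> (\<lambda>x. Y x \<bullet> grad \<zeta> x)"
  proof (rule set_integrable_continuous_bound[OF \<Omega>(1)])
    show "set_integrable lborel \<Omega> (\<lambda>x. B * norm (Y x))" using Y(3) by simp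
    show "\<bar>Y x \<bullet> grad \<zeta> x\<bar> \<le> \<bar>B * norm (Y x)\<bar>" if "x \<in> \<Omega>" for x
    proof -
      have "\<bar>Y x \<bullet> grad \<zeta> x\<bar> \<le> norm (Y x) * norm (grad \<zeta> x)" by (rule Cauchy_Schwarz_ineq2)
      also have "\<dots> \<le> norm (Y x) * B" using B that by (intro mult_left_mono) auto
      finally show ?thesis using B by (simp add: abs_mult mult.commute)
    qed
  qed (intro continuous_intros cont)
  show "set_integrable lborel \<Omega> (\<lambda>x. \<zeta> x * divergence Y x + Y x \<bullet> grad \<zeta> x)"
    using 1 2 by (rule set_integral_add)
qed

text \<open>As \<rho> has no critical point, it takes negative values arbitrarily close to any of
  its zeros, so each zero is a limit of points of \<Omega>. Hence the tangency condition is
  available on the whole zero level inside the chart.\<close>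

lemma outward_normal_of_chart:
  fixes \<Omega> :: "'a::euclidean_space set"
  assumes U: "open U" "C1_on U \<rho>" "\<And>y. y \<in> U \<Longrightarrow> grad \<rho> y \<noteq> 0"
    "\<Omega> \<inter> U = {y \<in> U. \<rho> y < 0}" and y: "y \<in> U" "\<rho> y = 0"
  shows "outward_unit_normal \<Omega> y (grad \<rho> y /\<^sub>R norm (grad \<rho> y))"
proof -
  have "y \<notin> \<Omega>" using U(4) y by (metis (mono_tags, lifting) IntI less_irrefl mem_Collect_eq)
  moreover have "y \<in> closure \<Omega>"
  proof (rule ccontr)
    assume "y \<notin> closure \<Omega>"
    then have "\<exists>z\<in>U - closure \<Omega>. \<rho> z < \<rho> y"
      using U y by (intro GDERIV_nonzero_imp_not_local_min[OF C1_onD(1)[OF U(2) y(1)]]) auto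
    then show False using U(4) y(2) closure_subset by fastforce
  qed
  ultimately have "y \<in> frontier \<Omega>" using interior_subset by (auto simp: frontier_def)
  with U y show ?thesis unfolding outward_unit_normal_def by blast
qed

text \<open>Cutting off with \<tau>(\<delta>) and integrating by parts equates the integral of
  \<tau> div(\<zeta> Y) with that of \<zeta> \<kappa> (Y \<bullet> grad \<rho>). The left side tends
  to the flux. On the right, the normal component is uniformly small in the layer, while the mass of
  \<zeta> \<kappa> stays bounded by the same identity for the constant field \<open>e\<close>.
  Nonnegativity of \<zeta> permits a pointwise comparison of the two right sides.\<close>

lemma weak_divergence_boundary_chart:
  fixes \<Omega> :: "'a::euclidean_space set"
  assumes \<Omega>: "open \<Omega>" "bounded \<Omega>" and Y: "C1_field_on \<Omega> Y"
    "set_integrable lborel \<Omega> (divergence Y)" "set_integrable lborel \<Omega> (\<lambda>x. norm (Y x))"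
    "tangential_at_boundary \<Omega> Y" and x0: "x0 \<in> regular_boundary \<Omega>"
  shows "\<exists>r>0. \<forall>\<zeta>. C1_on UNIV \<zeta> \<and> (\<forall>y. 0 \<le> \<zeta> y) \<and> (\<forall>y. r \<le> dist x0 y \<longrightarrow> \<zeta> y = 0) \<longrightarrow>
    weak_divergence \<Omega> Y \<zeta> = 0"
proof -
  obtain U \<rho> where U: "open U" "x0 \<in> U" "C1_on U \<rho>" "\<And>y. y \<in> U \<Longrightarrow> grad \<rho> y \<noteq> 0"
    "\<Omega> \<inter> U = {y \<in> U. \<rho> y < 0}"
    using x0 unfolding regular_boundary_def outward_unit_normal_def by blast
  obtain G where G: "continuous_on (\<Omega> \<union> regular_boundary \<Omega>) G"
    "\<And>x \<nu>. outward_unit_normal \<Omega> x \<nu> \<Longrightarrow> G x \<bullet> \<nu> = 0"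
    "\<And>x v. x \<in> \<Omega> \<Longrightarrow> \<bar>Y x \<bullet> v\<bar> \<le> \<bar>G x \<bullet> v\<bar>"
    using Y(4) unfolding tangential_at_boundary_def by blast
  \<comment> \<open>The gradient at the centre is transversal to the boundary. Half of its squared
    length is a lower bound for \<open>grad \<rho> y \<bullet> e\<close> that survives in a small
    ball.\<close>
  define e where "e = grad \<rho> x0"
  define c where "c = (e \<bullet> e) / 2"
  have c: "0 < c" using U(2,4) by (simp add: c_def e_def)
  have "open {y \<in> U. grad \<rho> y \<bullet> e \<in> {c<..}}"
    using U by (intro continuous_open_preimage[of U, unfolded vimage_def Int_def, simplified]
        continuous_intros C1_onD(2)) auto
  moreover have "x0 \<in> {y \<in> U. grad \<rho> y \<bullet> e \<in> {c<..}}"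
    using U(2) c by (simp add: c_def flip: e_def)
  ultimately obtain r where r: "0 < r" "cball x0 r \<subseteq> {y \<in> U. grad \<rho> y \<bullet> e \<in> {c<..}}"
    using open_contains_cball by blast
  define B where "B = cball x0 r"
  have B: "compact B" "B \<subseteq> U" "\<And>y. y \<in> B \<Longrightarrow> c < grad \<rho> y \<bullet> e"
    using r(2) by (auto simp: B_def)
  have \<rho>cont: "continuous_on B \<rho>"
    using C1_on_imp_continuous_on[OF U(3)] B(2) continuous_on_subset by blast
  have in\<Omega>: "y \<in> \<Omega> \<longleftrightarrow> \<rho> y < 0" if "y \<in> B" for y using U(5) B(2) that by blast
  have normal: "y \<in> regular_boundary \<Omega>" "G y \<bullet> grad \<rho> y = 0" if "y \<in> B" "\<rho> y = 0" for y
  proof -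
    have y: "y \<in> U" using that B(2) by blast
    note n = outward_normal_of_chart[OF U(1,3,4,5) y that(2)]
    show "y \<in> regular_boundary \<Omega>"
      unfolding regular_boundary_def using n by (metis (mono_tags, lifting) mem_Collect_eq outward_unit_normal_def)
    show "G y \<bullet> grad \<rho> y = 0" using G(2)[OF n] U(4)[OF y] by simp
  qed
  define K where "K = {y \<in> B. \<rho> y \<le> 0}"
  have compact_sub: "compact {y \<in> B. \<rho> y \<le> a}" for a
  proof -
    have "closed {y \<in> B. \<rho> y \<in> {..a}}"
      using \<rho>cont B(1) compact_imp_closed by (intro continuous_closed_preimage[of B, unfolded vimage_def Int_def, simplified]) auto
    then have "compact (B \<inter> {y \<in> B. \<rho> y \<in> {..a}})" using B(1) by (intro compact_Int_closed)
    also have "B \<inter> {y \<in> B. \<rho> y \<in> {..a}} = {y \<in> B. \<rho> y \<le> a}" by auto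
    finally show ?thesis .
  qed
  have K: "compact K" "K \<subseteq> \<Omega> \<union> regular_boundary \<Omega>" "K \<subseteq> B" "K \<subseteq> U"
    using compact_sub[of 0] in\<Omega> normal(1) B(2) by (force simp: K_def)+
  \<comment> \<open>The points of \<open>K\<close> where the normal component is at least \<epsilon>
    form a compact set that misses the zero level of \<rho>. The maximum of \<rho> on this set is
    negative and gives the depth \<delta>.\<close>
  have small: "\<exists>\<delta>>0. \<forall>y\<in>K. - \<delta> < \<rho> y \<longrightarrow> \<bar>G y \<bullet> grad \<rho> y\<bar> < \<epsilon>" if "0 < \<epsilon>" for \<epsilon>
  proof -
    let ?q = "\<lambda>y. \<bar>G y \<bullet> grad \<rho> y\<bar>"
    define C where "C = {y \<in> K. \<epsilon> \<le> ?q y}"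
    have "continuous_on K ?q"
      using K continuous_on_subset[OF G(1)] continuous_on_subset[OF C1_onD(2)[OF U(3)]]
      by (intro continuous_intros) auto
    then have "closed {y \<in> K. ?q y \<in> {\<epsilon>..}}"
      using K(1) compact_imp_closed by (intro continuous_closed_preimage[of K, unfolded vimage_def Int_def, simplified]) auto
    then have "compact (K \<inter> {y \<in> K. ?q y \<in> {\<epsilon>..}})" using K(1) by (intro compact_Int_closed)
    also have "K \<inter> {y \<in> K. ?q y \<in> {\<epsilon>..}} = C" by (auto simp: C_def)
    finally have C: "compact C" .
    show ?thesis
    proof (cases "C = {}")
      case True
      then show ?thesis by (intro exI[of _ 1]) (force simp: C_def)
    next
      case False
      have "continuous_on C \<rho>" by (rule continuous_on_subset[OF \<rho>cont]) (use K(3) in \<open>auto simp: C_def\<close>)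
      then obtain z where z: "z \<in> C" "\<And>y. y \<in> C \<Longrightarrow> \<rho> y \<le> \<rho> z"
        using continuous_attains_sup[OF C False] by blast
      have "\<rho> z \<noteq> 0" using z(1) normal(2)[of z] K(3) \<open>0 < \<epsilon>\<close> by (auto simp: C_def)
      then have "\<rho> z < 0" using z(1) by (auto simp: C_def K_def)
      moreover have "?q y < \<epsilon>" if "y \<in> K" "\<rho> z < \<rho> y" for y
        using that z(2)[of y] by (force simp: C_def)
      ultimately show ?thesis by (intro exI[of _ "- \<rho> z"]) auto
    qed
  qed
  have "weak_divergence \<Omega> Y \<zeta> = 0"
    if \<zeta>: "C1_on UNIV \<zeta>" "\<And>y. 0 \<le> \<zeta> y" "\<And>y. r \<le> dist x0 y \<Longrightarrow> \<zeta> y = 0" for \<zeta>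
  proof -
    have \<zeta>0: "\<zeta> y = 0" if "y \<notin> B" for y using that \<zeta>(3) by (simp add: B_def)
    have g\<zeta>0: "grad \<zeta> y = 0" if "y \<notin> B" for y
      using grad_eq_0_outside_closed[of B \<zeta>] \<zeta>0 that B(1) compact_imp_closed by blast
    \<comment> \<open>\<tau> is 0 for \<rho> \<ge> -\<delta> and 1 for \<rho> \<le> -2\<delta>; the
      shift by 1 keeps the support of \<tau> \<zeta> off the boundary. \<kappa> is the factor in
      grad \<tau> = -\<kappa> grad \<rho>, \<open>P\<close> the cut-off flux integrand and
      \<open>Q\<close> the boundary layer.\<close>
    define \<tau> where "\<tau> = (\<lambda>\<delta> y. smoothstep (- \<rho> y / \<delta> - 1))"
    define \<kappa> where "\<kappa> = (\<lambda>\<delta> y. smoothstep' (- \<rho> y / \<delta> - 1) / \<delta>)"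
    define P where "P = (\<lambda>Z \<delta> y. \<tau> \<delta> y * (\<zeta> y * divergence Z y + Z y \<bullet> grad \<zeta> y))"
    define Q where "Q = (\<lambda>Z \<delta> y. \<zeta> y * \<kappa> \<delta> y * (Z y \<bullet> grad \<rho> y))"
    \<comment> \<open>The integral of div(\<tau> \<zeta> Z) = P - Q vanishes by compact support.
      \<open>Z\<close> is left open because both \<open>Y\<close> and the constant field
      \<open>e\<close> will be inserted.\<close>
    have cut: "set_integrable lborel \<Omega> (P Z \<delta>)" "set_integrable lborel \<Omega> (Q Z \<delta>)"
      "(LINT x:\<Omega>|lborel. P Z \<delta> x) = (LINT x:\<Omega>|lborel. Q Z \<delta> x)"
      if \<delta>: "0 < \<delta>" and Z: "C1_field_on \<Omega> Z" "set_integrable lborel \<Omega> (divergence Z)"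
        "set_integrable lborel \<Omega> (\<lambda>x. norm (Z x))" for Z \<delta>
    proof -
      \<comment> \<open>\<rho> is controlled on \<open>U\<close> only, but \<zeta> vanishes off
        \<open>B\<close>, so the extension by zero is C^1 on the union of \<open>U\<close> and the
        complement of \<open>B\<close>, which is everything.\<close>
      define \<xi> where "\<xi> = (\<lambda>y. if y \<in> U then \<tau> \<delta> y * \<zeta> y else 0)"
      have lin: "DERIV (\<lambda>t. smoothstep (- t / \<delta> - 1)) t :> smoothstep' (- t / \<delta> - 1) * (- 1 / \<delta>)" for t
        by (rule DERIV_chain2[OF DERIV_smoothstep]) (use \<delta> in \<open>auto intro!: derivative_eq_intros\<close>)
      have \<tau>C1: "C1_on U (\<tau> \<delta>)"
        unfolding \<tau>_def using \<delta>
        by (intro C1_on_compose[OF U(3) lin] continuous_intros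
            continuous_on_compose2[OF continuous_on_smoothstep'[of UNIV]]) auto
      have g\<tau>: "grad (\<tau> \<delta>) y = - \<kappa> \<delta> y *\<^sub>R grad \<rho> y" if "y \<in> U" for y
        unfolding \<tau>_def \<kappa>_def using grad_compose[OF U(3) that lin[of "\<rho> y"]] by simp
      have \<zeta>U: "C1_on U \<zeta>" using \<zeta>(1) C1_on_subset by blast
      note \<xi>U = C1_on_transform_open[OF C1_on_mult[OF \<tau>C1 \<zeta>U] U(1), of \<xi>]
      have "C1_on U \<xi>" by (rule \<xi>U(1)) (simp add: \<xi>_def)
      moreover have "C1_on (- B) \<xi>"
        by (rule C1_on_transform_open(1)[OF C1_on_const[where c = 0]])
          (use \<zeta>0 B(1) compact_imp_closed in \<open>auto simp: \<xi>_def\<close>)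
      ultimately have "C1_on (U \<union> - B) \<xi>"
        using U(1) B(1) compact_imp_closed by (intro C1_on_Un) auto
      then have \<xi>C1: "C1_on \<Omega> \<xi>" by (rule C1_on_subset) (use B(2) in auto)
      define K\<delta> where "K\<delta> = {y \<in> B. \<rho> y \<le> - \<delta>}"
      have "\<xi> y = 0" if "y \<in> \<Omega> - K\<delta>" for y
      proof (cases "y \<in> B")
        case True
        with that have "- \<rho> y / \<delta> - 1 \<le> 0" using \<delta> by (auto simp: K\<delta>_def field_simps)
        then show ?thesis by (simp add: \<xi>_def \<tau>_def smoothstep_eq_0)
      qed (simp add: \<xi>_def \<zeta>0)
      moreover have "compact K\<delta>" "K\<delta> \<subseteq> \<Omega>"
        using compact_sub \<delta> in\<Omega> by (auto simp: K\<delta>_def)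
      ultimately have total: "set_integrable lborel \<Omega> (\<lambda>x. \<xi> x * divergence Z x + Z x \<bullet> grad \<xi> x)"
        "(LINT x:\<Omega>|lborel. \<xi> x * divergence Z x + Z x \<bullet> grad \<xi> x) = 0"
        using integral_divergence_compact_support[OF \<Omega>(1) Z(1) \<xi>C1] by blast+
      have split: "\<xi> y * divergence Z y + Z y \<bullet> grad \<xi> y = P Z \<delta> y - Q Z \<delta> y" for y
      proof (cases "y \<in> B")
        case True
        then have y: "y \<in> U" using B(2) by blast
        then have g: "grad \<xi> y = \<tau> \<delta> y *\<^sub>R grad \<zeta> y + \<zeta> y *\<^sub>R (- \<kappa> \<delta> y *\<^sub>R grad \<rho> y)"
          using \<xi>U(2)[OF _ y] grad_mult[OF \<tau>C1 \<zeta>U y] g\<tau>[OF y] by (simp add: \<xi>_def)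
        have "Z y \<bullet> grad \<xi> y = \<tau> \<delta> y * (Z y \<bullet> grad \<zeta> y) - \<zeta> y * \<kappa> \<delta> y * (Z y \<bullet> grad \<rho> y)"
          unfolding g by (simp add: inner_simps)
        moreover have "\<xi> y = \<tau> \<delta> y * \<zeta> y" using y by (simp add: \<xi>_def)
        ultimately show ?thesis by (simp add: P_def Q_def algebra_simps)
      next
        case False
        have "grad \<xi> y = 0"
        proof (rule grad_eq_0_outside_closed)
          show "closed B" using B(1) by (rule compact_imp_closed)
          show "\<xi> x = 0" if "x \<notin> B" for x using \<zeta>0[OF that] by (simp add: \<xi>_def)
        qed (rule False)
        then show ?thesis using False by (simp add: P_def Q_def \<xi>_def \<zeta>0 g\<zeta>0)
      qed
      show P: "set_integrable lborel \<Omega> (P Z \<delta>)"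
      proof (rule set_integrable_continuous_bound[OF \<Omega>(1)])
        show "set_integrable lborel \<Omega> (\<lambda>x. \<zeta> x * divergence Z x + Z x \<bullet> grad \<zeta> x)"
          by (rule set_integrable_weak_divergence[OF \<Omega> Z \<zeta>(1)])
        have "continuous_on (\<Omega> \<inter> U) (P Z \<delta>)"
          unfolding P_def
          by (intro continuous_intros continuous_on_subset[OF C1_on_imp_continuous_on[OF \<tau>C1]]
              continuous_on_subset[OF C1_on_imp_continuous_on[OF \<zeta>(1)]]
              continuous_on_subset[OF C1_onD(2)[OF \<zeta>(1)]]
              continuous_on_subset[OF C1_field_on_imp_continuous_on[OF Z(1)]]
              continuous_on_subset[OF continuous_on_divergence[OF Z(1)]]) auto
        moreover have "continuous_on (\<Omega> - B) (P Z \<delta>)"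
          by (rule continuous_on_eq[of _ "\<lambda>x. 0"]) (auto simp: P_def \<zeta>0 g\<zeta>0)
        ultimately have "continuous_on (\<Omega> \<inter> U \<union> (\<Omega> - B)) (P Z \<delta>)"
          using \<Omega>(1) U(1) B(1) compact_imp_closed by (intro continuous_on_open_Un) auto
        then show "continuous_on \<Omega> (P Z \<delta>)" by (rule continuous_on_subset) (use B(2) in auto)
        show "\<bar>P Z \<delta> x\<bar> \<le> \<bar>\<zeta> x * divergence Z x + Z x \<bullet> grad \<zeta> x\<bar>" for x
          unfolding P_def \<tau>_def abs_mult using smoothstep_bounds
          by (auto intro!: mult_left_le_one_le)
      qed
      have Qeq: "Q Z \<delta> x = P Z \<delta> x - (\<xi> x * divergence Z x + Z x \<bullet> grad \<xi> x)" for x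
        using split[of x] by simp
      show Q: "set_integrable lborel \<Omega> (Q Z \<delta>)"
        unfolding Qeq[abs_def] using P total(1) by (rule set_integral_diff)
      show "(LINT x:\<Omega>|lborel. P Z \<delta> x) = (LINT x:\<Omega>|lborel. Q Z \<delta> x)"
        using total(2) P Q unfolding split by (simp add: set_integral_diff)
    qed
    define C0 where "C0 = (LINT x:\<Omega>|lborel. \<bar>e \<bullet> grad \<zeta> x\<bar>)"
    have const: "C1_field_on \<Omega> (\<lambda>x. e)" "set_integrable lborel \<Omega> (divergence (\<lambda>x. e))"
        "set_integrable lborel \<Omega> (\<lambda>x. norm e)"
      using C1_field_on_const \<Omega> by (auto intro!: set_integrable_bounded_continuous)
    have e_int: "set_integrable lborel \<Omega> (\<lambda>x. \<bar>e \<bullet> grad \<zeta> x\<bar>)"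
      using set_integrable_weak_divergence(2)[OF \<Omega> const \<zeta>(1)] by (rule set_integrable_abs)
    \<comment> \<open>\<open>e\<close> has no divergence and \<tau> lies in [0, 1], so
      \<open>C0\<close> does not depend on \<delta>. Since \<open>e \<bullet> grad \<rho>\<close>
      exceeds \<open>c\<close> on \<open>B\<close>, the weight \<zeta> \<kappa> has mass at most
      \<open>C0 / c\<close> over \<Omega>, although \<kappa> is of order 1 / \<delta>.\<close>
    have Qe: "(LINT x:\<Omega>|lborel. Q (\<lambda>x. e) \<delta> x) \<le> C0" if "0 < \<delta>" for \<delta>
    proof -
      have "(LINT x:\<Omega>|lborel. P (\<lambda>x. e) \<delta> x) \<le> C0"
        unfolding C0_def
      proof (rule set_integral_mono[OF cut(1)[OF that const] e_int])
        show "P (\<lambda>x. e) \<delta> x \<le> \<bar>e \<bullet> grad \<zeta> x\<bar>" for x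
        proof -
          have "P (\<lambda>x. e) \<delta> x \<le> \<tau> \<delta> x * \<bar>e \<bullet> grad \<zeta> x\<bar>"
            unfolding P_def \<tau>_def using smoothstep_bounds by (intro mult_left_mono) auto
          also have "\<dots> \<le> \<bar>e \<bullet> grad \<zeta> x\<bar>"
            unfolding \<tau>_def using smoothstep_bounds by (intro mult_left_le_one_le) auto
          finally show ?thesis .
        qed
      qed
      then show ?thesis using cut(3)[OF that const] by simp
    qed
    have bound: "\<bar>LINT x:\<Omega>|lborel. P Y \<delta> x\<bar> \<le> \<epsilon> / c * C0"
      if \<delta>: "0 < \<delta>" "\<And>y. y \<in> K \<Longrightarrow> - (2 * \<delta>) < \<rho> y \<Longrightarrow> \<bar>G y \<bullet> grad \<rho> y\<bar> < \<epsilon>" and "0 < \<epsilon>" for \<delta> \<epsilon>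
    proof -
      note cY = cut[OF \<delta>(1) Y(1-3)] and ce = cut[OF \<delta>(1) const]
      have pw: "\<bar>Q Y \<delta> x\<bar> \<le> \<epsilon> / c * Q (\<lambda>x. e) \<delta> x" if x: "x \<in> \<Omega>" for x
      proof (cases "x \<in> B \<and> \<kappa> \<delta> x \<noteq> 0")
        case False
        then show ?thesis using \<zeta>0[of x] by (auto simp: Q_def)
      next
        case True
        \<comment> \<open>\<kappa> vanishes once -\<rho> / \<delta> - 1 reaches 1; this is the
          origin of the depth 2 \<delta> in the assumption.\<close>
        then have "\<not> (1 \<le> - \<rho> x / \<delta> - 1)"
          using smoothstep'_eq_0 by (auto simp: \<kappa>_def)
        then have "- (2 * \<delta>) < \<rho> x" using \<delta>(1) by (simp add: field_simps)
        moreover have "x \<in> K" using True in\<Omega>[of x] x by (auto simp: K_def)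
        ultimately have "\<bar>G x \<bullet> grad \<rho> x\<bar> < \<epsilon>" by (intro \<delta>(2))
        then have "\<bar>Y x \<bullet> grad \<rho> x\<bar> \<le> \<epsilon>" using G(3)[OF x, of "grad \<rho> x"] by linarith
        also have "\<epsilon> \<le> \<epsilon> / c * (e \<bullet> grad \<rho> x)"
          using B(3)[of x] True c \<open>0 < \<epsilon>\<close> by (simp add: field_simps inner_commute)
        finally have "\<zeta> x * \<kappa> \<delta> x * \<bar>Y x \<bullet> grad \<rho> x\<bar> \<le> \<zeta> x * \<kappa> \<delta> x * (\<epsilon> / c * (e \<bullet> grad \<rho> x))"
          using \<zeta>(2) smoothstep'_nonneg \<delta>(1) by (intro mult_left_mono) (auto simp: \<kappa>_def)
        moreover have "\<bar>\<zeta> x * \<kappa> \<delta> x\<bar> = \<zeta> x * \<kappa> \<delta> x"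
          using \<zeta>(2) smoothstep'_nonneg \<delta>(1) by (auto simp: \<kappa>_def)
        ultimately have "\<bar>Q Y \<delta> x\<bar> \<le> \<zeta> x * \<kappa> \<delta> x * (\<epsilon> / c * (e \<bullet> grad \<rho> x))"
          unfolding Q_def abs_mult[of "\<zeta> x * \<kappa> \<delta> x"] by (simp only:)
        then show ?thesis by (simp add: Q_def mult_ac)
      qed
      have "\<bar>LINT x:\<Omega>|lborel. Q Y \<delta> x\<bar> \<le> (LINT x:\<Omega>|lborel. \<bar>Q Y \<delta> x\<bar>)"
        using set_integral_norm_bound[OF cY(2)] by simp
      also have "\<dots> \<le> (LINT x:\<Omega>|lborel. \<epsilon> / c * Q (\<lambda>x. e) \<delta> x)"
        by (rule set_integral_mono) (use set_integrable_abs[OF cY(2)] ce(2) pw in auto)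
      also have "\<dots> = \<epsilon> / c * (LINT x:\<Omega>|lborel. Q (\<lambda>x. e) \<delta> x)" by simp
      also have "\<dots> \<le> \<epsilon> / c * C0"
        using Qe[OF \<delta>(1)] \<open>0 < \<epsilon>\<close> c by (intro mult_left_mono) auto
      finally show ?thesis using cY(3) by simp
    qed
    have lim: "(\<lambda>n. LINT x:\<Omega>|lborel. P Y (inverse (real (Suc n))) x) \<longlonglongrightarrow> weak_divergence \<Omega> Y \<zeta>"
      unfolding weak_divergence_def set_lebesgue_integral_def
    proof (rule integral_dominated_convergence)
      let ?f = "\<lambda>x. \<zeta> x * divergence Y x + Y x \<bullet> grad \<zeta> x"
      have "set_integrable lborel \<Omega> ?f"
        by (rule set_integrable_weak_divergence[OF \<Omega> Y(1-3) \<zeta>(1)])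
      then show "(\<lambda>x. indicator \<Omega> x *\<^sub>R ?f x) \<in> borel_measurable lborel"
        "integrable lborel (\<lambda>x. norm (indicator \<Omega> x *\<^sub>R ?f x))"
        unfolding set_integrable_def by (auto intro: integrable_norm)
      show "(\<lambda>x. indicator \<Omega> x *\<^sub>R P Y (inverse (real (Suc n))) x) \<in> borel_measurable lborel" for n
        using cut(1)[of "inverse (real (Suc n))", OF _ Y(1-3)] unfolding set_integrable_def by auto
      show "AE x in lborel. norm (indicator \<Omega> x *\<^sub>R P Y (inverse (real (Suc n))) x) \<le> norm (indicator \<Omega> x *\<^sub>R ?f x)" for n
        unfolding P_def \<tau>_def using smoothstep_bounds
        by (intro AE_I2) (auto simp: abs_mult indicator_def intro!: mult_left_le_one_le)
      show "AE x in lborel. (\<lambda>n. indicator \<Omega> x *\<^sub>R P Y (inverse (real (Suc n))) x) \<longlonglongrightarrow> indicator \<Omega> x *\<^sub>R ?f x"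
      proof (rule AE_I2)
        fix x
        show "(\<lambda>n. indicator \<Omega> x *\<^sub>R P Y (inverse (real (Suc n))) x) \<longlonglongrightarrow> indicator \<Omega> x *\<^sub>R ?f x"
        proof (cases "x \<in> \<Omega> \<inter> B")
          case True
          then have "0 < - \<rho> x" using in\<Omega> by auto
          \<comment> \<open>For \<delta> = 1 / (n + 1) the argument of \<open>smoothstep\<close> is
            -(n + 1) \<rho> x - 1, which is at least 1 from \<open>N\<close> on.\<close>
          then obtain N where N: "2 < real N * (- \<rho> x)" using reals_Archimedean3 by blast
          have "\<tau> (inverse (real (Suc n))) x = 1" if "N \<le> n" for n
          proof -
            have "real N * (- \<rho> x) \<le> real (Suc n) * (- \<rho> x)"
              using that \<open>0 < - \<rho> x\<close> by (intro mult_right_mono) auto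
            with N show ?thesis
              unfolding \<tau>_def by (intro smoothstep_eq_1) (simp add: divide_inverse mult.commute del: of_nat_Suc)
          qed
          then have "P Y (inverse (real (Suc n))) x = ?f x" if "N \<le> n" for n
            using that by (simp add: P_def del: of_nat_Suc)
          then show ?thesis
            by (intro tendsto_eventually eventually_sequentiallyI[of N]) (simp del: of_nat_Suc)
        next
          case False
          then have "indicator \<Omega> x *\<^sub>R P Y \<delta> x = 0" "indicator \<Omega> x *\<^sub>R ?f x = 0" for \<delta>
            using \<zeta>0 g\<zeta>0 by (auto simp: P_def indicator_def)
          then show ?thesis by (simp only: tendsto_const)
        qed
      qed
    qed
    have "\<bar>weak_divergence \<Omega> Y \<zeta>\<bar> \<le> \<epsilon> / c * C0" if \<epsilon>: "0 < \<epsilon>" for \<epsilon>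
    proof -
      obtain d where d: "0 < d" "\<And>y. y \<in> K \<Longrightarrow> - d < \<rho> y \<Longrightarrow> \<bar>G y \<bullet> grad \<rho> y\<bar> < \<epsilon>"
        using small[OF \<epsilon>] by blast
      obtain N where N: "inverse (real (Suc N)) < d / 2"
        using reals_Archimedean[of "d / 2"] d(1) by auto
      have "\<bar>LINT x:\<Omega>|lborel. P Y (inverse (real (Suc n))) x\<bar> \<le> \<epsilon> / c * C0" if "N \<le> n" for n
      proof (rule bound[OF _ _ \<epsilon>])
        have "inverse (real (Suc n)) \<le> inverse (real (Suc N))"
          using that by (intro le_imp_inverse_le) auto
        then show "\<bar>G y \<bullet> grad \<rho> y\<bar> < \<epsilon>" if "y \<in> K" "- (2 * inverse (real (Suc n))) < \<rho> y" for y
          using that d(2)[of y] N by linarith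
      qed simp
      then show ?thesis
        by (intro tendsto_upperbound[OF tendsto_rabs[OF lim]] eventually_sequentiallyI[of N]) auto
    qed
    then have "\<bar>weak_divergence \<Omega> Y \<zeta>\<bar> \<le> \<epsilon>" if "0 < \<epsilon>" for \<epsilon>
    proof -
      have "C0 \<ge> 0" unfolding C0_def set_lebesgue_integral_def by simp
      have "\<bar>weak_divergence \<Omega> Y \<zeta>\<bar> \<le> (\<epsilon> * c / (C0 + 1)) / c * C0"
        using that c \<open>C0 \<ge> 0\<close> by (intro \<open>\<And>\<epsilon>. 0 < \<epsilon> \<Longrightarrow> \<bar>weak_divergence \<Omega> Y \<zeta>\<bar> \<le> \<epsilon> / c * C0\<close>) auto
      also have "\<dots> = \<epsilon> * (C0 / (C0 + 1))" using c by simp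
      also have "\<dots> \<le> \<epsilon> * 1" using that \<open>C0 \<ge> 0\<close> by (intro mult_left_mono) auto
      finally show ?thesis by simp
    qed
    then show ?thesis using field_le_epsilon[of "\<bar>weak_divergence \<Omega> Y \<zeta>\<bar>" 0] by auto
  qed
  with r(1) show ?thesis by blast
qed

text \<open>Here \<zeta> already has compact support in \<Omega>. The conclusion has the form of the
  boundary case, so that interior and boundary points enter one covering argument.\<close>

lemma weak_divergence_interior_chart:
  fixes \<Omega> :: "'a::euclidean_space set"
  assumes "open \<Omega>" "C1_field_on \<Omega> Y" "x0 \<in> \<Omega>"
  shows "\<exists>r>0. \<forall>\<zeta>. C1_on UNIV \<zeta> \<and> (\<forall>y. 0 \<le> \<zeta> y) \<and> (\<forall>y. r \<le> dist x0 y \<longrightarrow> \<zeta> y = 0) \<longrightarrow>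
    weak_divergence \<Omega> Y \<zeta> = 0"
proof -
  obtain r where r: "0 < r" "cball x0 r \<subseteq> \<Omega>"
    using assms open_contains_cball by blast
  have "weak_divergence \<Omega> Y \<zeta> = 0"
    if "C1_on UNIV \<zeta>" "\<And>y. r \<le> dist x0 y \<Longrightarrow> \<zeta> y = 0" for \<zeta>
    unfolding weak_divergence_def
    by (rule integral_divergence_compact_support(2)[of _ _ _ "cball x0 r"])
      (use assms r that C1_on_subset[OF that(1) subset_UNIV] in auto)
  with r(1) show ?thesis by blast
qed

section \<open>Gluing the local results\<close>

lemma weak_divergence_bump_split:
  fixes \<Omega> :: "'a::euclidean_space set"
  assumes \<Omega>: "open \<Omega>" "bounded \<Omega>" and Y: "C1_field_on \<Omega> Y"
    "set_integrable lborel \<Omega> (divergence Y)" "set_integrable lborel \<Omega> (\<lambda>x. norm (Y x))"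
    and \<eta>: "C1_on UNIV \<eta>" and b: "C1_on UNIV b"
  shows "weak_divergence \<Omega> Y \<eta> =
    weak_divergence \<Omega> Y (\<lambda>y. \<eta> y * b y) + weak_divergence \<Omega> Y (\<lambda>y. \<eta> y * (1 - b y))"
proof -
  have b': "C1_on UNIV (\<lambda>y. 1 - b y)" by (intro C1_on_diff C1_on_const b)
  have "grad (\<lambda>y. \<eta> y * b y) x + grad (\<lambda>y. \<eta> y * (1 - b y)) x = grad \<eta> x" for x
    unfolding grad_mult[OF \<eta> b UNIV_I] grad_mult[OF \<eta> b' UNIV_I] grad_diff[OF C1_on_const b UNIV_I]
    by (simp add: algebra_simps)
  then have "Y x \<bullet> grad (\<lambda>y. \<eta> y * b y) x + Y x \<bullet> grad (\<lambda>y. \<eta> y * (1 - b y)) x = Y x \<bullet> grad \<eta> x" for x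
    by (simp flip: inner_add_right)
  then have "(\<eta> x * b x * divergence Y x + Y x \<bullet> grad (\<lambda>y. \<eta> y * b y) x) +
      (\<eta> x * (1 - b x) * divergence Y x + Y x \<bullet> grad (\<lambda>y. \<eta> y * (1 - b y)) x) =
      \<eta> x * divergence Y x + Y x \<bullet> grad \<eta> x" for x
    by (simp add: algebra_simps)
  then show ?thesis
    unfolding weak_divergence_def
    using set_integral_add(2)[OF
        set_integrable_weak_divergence(3)[OF \<Omega> Y C1_on_mult[OF \<eta> b]]
        set_integrable_weak_divergence(3)[OF \<Omega> Y C1_on_mult[OF \<eta> b']]] by simp
qed

lemma weak_divergence_eq_0_on:
  fixes \<Omega> :: "'a::euclidean_space set"
  assumes "open \<Omega>" "\<And>x. x \<in> \<Omega> \<Longrightarrow> \<eta> x = 0"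
  shows "weak_divergence \<Omega> Y \<eta> = 0"
proof -
  have "grad \<eta> x = 0" if "x \<in> \<Omega>" for x
    using grad_eq_0_outside_closed[of "- \<Omega>" \<eta> x] assms that by auto
  then have "indicator \<Omega> x *\<^sub>R (\<eta> x * divergence Y x + Y x \<bullet> grad \<eta> x) = 0" for x
    using assms(2) by (cases "x \<in> \<Omega>") auto
  then show ?thesis unfolding weak_divergence_def set_lebesgue_integral_def by (simp only: integral_zero)
qed

text \<open>The part of the closure outside the d-neighbourhood of the singular set is compact, so
  finitely many good balls cover it. Multiplying \<eta> by the factors 1 - bump one after the other
  leaves the flux unchanged and ends with a function that is zero on \<Omega>.\<close>

lemma weak_divergence_off_singular_boundary:
  fixes \<Omega> :: "'a::euclidean_space set"
  assumes \<Omega>: "open \<Omega>" "bounded \<Omega>" and Y: "C1_field_on \<Omega> Y"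
    "set_integrable lborel \<Omega> (divergence Y)" "set_integrable lborel \<Omega> (\<lambda>x. norm (Y x))"
    "tangential_at_boundary \<Omega> Y"
    and \<eta>: "C1_on UNIV \<eta>" "\<And>y. 0 \<le> \<eta> y" and "0 < d"
    and off: "\<And>x y. x \<in> singular_boundary \<Omega> \<Longrightarrow> dist x y < d \<Longrightarrow> \<eta> y = 0"
  shows "weak_divergence \<Omega> Y \<eta> = 0"
proof -
  define L where "L = (\<lambda>x r. 0 < r \<and> (\<forall>\<zeta>. C1_on UNIV \<zeta> \<and> (\<forall>y. 0 \<le> \<zeta> y) \<and>
    (\<forall>y. r \<le> dist x y \<longrightarrow> \<zeta> y = 0) \<longrightarrow> weak_divergence \<Omega> Y \<zeta> = 0))"
  define K where "K = closure \<Omega> - (\<Union>x\<in>singular_boundary \<Omega>. ball x d)"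
  have "compact (closure \<Omega> \<inter> - (\<Union>x\<in>singular_boundary \<Omega>. ball x d))"
    using \<Omega>(2) by (intro compact_Int_closed) auto
  then have "compact K" by (simp add: K_def Diff_eq)
  have "\<exists>r. L x r" if "x \<in> K" for x
  proof (cases "x \<in> \<Omega>")
    case True
    then show ?thesis using weak_divergence_interior_chart[OF \<Omega>(1) Y(1) True] by (simp add: L_def)
  next
    case False
    have "x \<in> frontier \<Omega>" using that False \<Omega>(1) by (auto simp: K_def frontier_def interior_open)
    moreover have "x \<notin> singular_boundary \<Omega>" using that \<open>0 < d\<close> by (auto simp: K_def)
    ultimately have "x \<in> regular_boundary \<Omega>" by (simp add: singular_boundary_def)
    then show ?thesis
      using weak_divergence_boundary_chart[OF \<Omega> Y] by (simp add: L_def)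
  qed
  then obtain r where r: "\<And>x. x \<in> K \<Longrightarrow> L x (r x)" by metis
  then have r0: "0 < r x" if "x \<in> K" for x using that by (simp add: L_def)
  \<comment> \<open>Half radii, because \<open>bump x (r x)\<close> equals 1 on the ball of half the
    radius.\<close>
  have "K \<subseteq> (\<Union>x\<in>K. ball x (r x / 2))" using r0 by auto
  then obtain F where F: "F \<subseteq> K" "finite F" "K \<subseteq> (\<Union>x\<in>F. ball x (r x / 2))"
    using compactE_image[OF \<open>compact K\<close>, of K "\<lambda>x. ball x (r x / 2)"] by auto
  \<comment> \<open>Each step splits \<xi> into \<xi> b and \<xi> (1 - b), the first of which lives
    in a good ball and has zero flux. The second becomes the test function of the next step, so
    \<xi> is arbitrary in the induction.\<close>
  have "weak_divergence \<Omega> Y \<xi> = weak_divergence \<Omega> Y (\<lambda>y. \<xi> y * (\<Prod>x\<in>F. 1 - bump x (r x) y))"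
    if "C1_on UNIV \<xi>" "\<And>y. 0 \<le> \<xi> y" for \<xi>
    using F(2,1) that
  proof (induction F arbitrary: \<xi> rule: finite_induct)
    case (insert a F)
    let ?b = "bump a (r a)"
    let ?\<xi> = "\<lambda>y. \<xi> y * (1 - ?b y)"
    have "weak_divergence \<Omega> Y (\<lambda>y. \<xi> y * ?b y) = 0"
    proof -
      have "L a (r a)" using insert.prems r by blast
      moreover have "\<xi> y * ?b y = 0" if "r a \<le> dist a y" for y
        using that bump_eq_0 insert.prems r0 by force
      ultimately show ?thesis
        using C1_on_mult[OF insert.prems(2) C1_on_bump[of UNIV a "r a"]] insert.prems(3) bump_bounds
        unfolding L_def by (metis (no_types, lifting) mult_nonneg_nonneg)
    qed
    then have "weak_divergence \<Omega> Y \<xi> = weak_divergence \<Omega> Y ?\<xi>"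
      using weak_divergence_bump_split[OF \<Omega> Y(1-3) insert.prems(2) C1_on_bump[of UNIV a "r a"]] by simp
    also have "\<dots> = weak_divergence \<Omega> Y (\<lambda>y. ?\<xi> y * (\<Prod>x\<in>F. 1 - bump x (r x) y))"
    proof (rule insert.IH)
      show "C1_on UNIV ?\<xi>" by (intro C1_on_mult insert.prems(2) C1_on_diff C1_on_const C1_on_bump)
      show "0 \<le> ?\<xi> y" for y
        using insert.prems(3)[of y] bump_bounds[of a "r a" y] by (intro mult_nonneg_nonneg) auto
    qed (use insert.prems in auto)
    finally show ?case using insert.hyps by (simp add: mult.assoc)
  qed simp
  from this[OF \<eta>] have "weak_divergence \<Omega> Y \<eta> = weak_divergence \<Omega> Y (\<lambda>y. \<eta> y * (\<Prod>x\<in>F. 1 - bump x (r x) y))" .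
  also have "\<dots> = 0"
  proof (rule weak_divergence_eq_0_on[OF \<Omega>(1)])
    fix y assume "y \<in> \<Omega>"
    show "\<eta> y * (\<Prod>x\<in>F. 1 - bump x (r x) y) = 0"
    proof (cases "y \<in> K")
      case True
      then obtain x where x: "x \<in> F" "dist x y < r x / 2" using F(3) by auto
      then have "bump x (r x) y = 1" using r0 F(1) by (intro bump_eq_1) auto
      then show ?thesis using x(1) F(2) by (auto intro!: prod_zero)
    next
      case False
      then obtain x where "x \<in> singular_boundary \<Omega>" "dist x y < d"
        using \<open>y \<in> \<Omega>\<close> closure_subset by (auto simp: K_def)
      then show ?thesis using off by simp
    qed
  qed
  finally show ?thesis .
qed

text \<open>By AM-GM, \<open>\<bar>Y \<bullet> grad \<eta>\<bar> \<le> (|Y|\<^sup>2 / t + t |grad \<eta>|\<^sup>2) / 2\<close>; near the singular set the first term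
  tends to zero after integration and the second one is bounded by a multiple of \<open>t\<close>.\<close>

theorem integral_divergence_tangential:
  fixes \<Omega> :: "'a::euclidean_space set"
  assumes \<Omega>: "open \<Omega>" "bounded \<Omega>"
    and sing: "\<And>\<epsilon>. 0 < \<epsilon> \<Longrightarrow> \<epsilon> \<le> 1 \<Longrightarrow>
      measure lebesgue (\<Union>x\<in>singular_boundary \<Omega>. ball x \<epsilon>) \<le> C * \<epsilon>\<^sup>2"
    and Y: "C1_field_on \<Omega> Y" "set_integrable lborel \<Omega> (divergence Y)"
      "set_integrable lborel \<Omega> (\<lambda>x. (norm (Y x))\<^sup>2)" "tangential_at_boundary \<Omega> Y"
  shows "(LINT x:\<Omega>|lborel. divergence Y x) = 0"
proof -
  define S where "S = singular_boundary \<Omega>"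
  have S: "bounded S" "S \<inter> \<Omega> = {}" "closed (frontier \<Omega>)" "S \<subseteq> frontier \<Omega>"
    using bounded_subset[OF bounded_closure[OF \<Omega>(2)]] \<Omega>(1)
    by (auto simp: S_def singular_boundary_def frontier_def interior_open)
  have Y1: "set_integrable lborel \<Omega> (\<lambda>x. norm (Y x))"
  proof (rule set_integrable_continuous_bound[OF \<Omega>(1)])
    show "set_integrable lborel \<Omega> (\<lambda>x. 1 + (norm (Y x))\<^sup>2)"
      by (intro set_integral_add Y(3) set_integrable_bounded_continuous[OF \<Omega>, where B = 1]) auto
    show "\<bar>norm (Y x)\<bar> \<le> \<bar>1 + (norm (Y x))\<^sup>2\<bar>" for x
    proof -
      have "2 * norm (Y x) \<le> 1 + (norm (Y x))\<^sup>2"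
        using zero_le_power2[of "norm (Y x) - 1"] by (simp add: power2_eq_square algebra_simps)
      then show ?thesis using norm_ge_zero[of "Y x"] by linarith
    qed
  qed (intro continuous_intros C1_field_on_imp_continuous_on Y(1))
  \<comment> \<open>At radius 1 / (n + 1) the gradient bound of the cutoff becomes \<open>A\<close>
    (n + 1).\<close>
  define A :: real where "A = 9 ^ DIM('a) * 6"
  define N where "N = (\<lambda>n. \<Union>x\<in>S. ball x (inverse (real (Suc n))))"
  have Nopen: "open (N n)" for n by (auto simp: N_def)
  have Nbd: "bounded (N n)" for n
  proof -
    obtain R where "\<And>x. x \<in> S \<Longrightarrow> norm x \<le> R" using S(1) by (auto simp: bounded_iff)
    then have "norm y \<le> R + 1" if "y \<in> N n" for y
    proof -
      from that obtain x where "x \<in> S" "dist x y < inverse (real (Suc n))" by (auto simp: N_def)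
      moreover have "inverse (real (Suc n)) \<le> 1" by (simp add: inverse_le_1_iff)
      ultimately show ?thesis
        using \<open>\<And>x. x \<in> S \<Longrightarrow> norm x \<le> R\<close>[of x] norm_triangle_ineq2[of y x]
        by (simp add: dist_norm norm_minus_commute)
    qed
    then show ?thesis by (auto simp: bounded_iff)
  qed
  have Nmeas: "measure lborel (N n) \<le> C * (inverse (real (Suc n)))\<^sup>2" for n
    using sing[of "inverse (real (Suc n))"] Nopen[of n]
    by (simp add: N_def S_def inverse_le_1_iff del: of_nat_Suc)
  have "0 \<le> C" using sing[of 1] measure_nonneg[of lebesgue] by (smt (verit) mult_cancel_left2 one_power2 zero_less_one)
  \<comment> \<open>A point of \<Omega> has positive distance to the frontier, so it leaves the
    shrinking neighbourhoods \<open>N n\<close>. Both dominated convergence arguments below rest on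
    this.\<close>
  have leave: "\<exists>n0. \<forall>n\<ge>n0. x \<notin> N n" if "x \<in> \<Omega>" for x
  proof -
    have "x \<notin> frontier \<Omega>" using that \<Omega>(1) by (auto simp: frontier_def interior_open)
    then obtain e where e: "0 < e" "ball x e \<inter> frontier \<Omega> = {}"
      using S(3) open_contains_ball[of "- frontier \<Omega>"] by (auto simp: open_Compl disjoint_eq_subset_Compl)
    obtain n0 where n0: "inverse (real (Suc n0)) < e" using reals_Archimedean e(1) by blast
    have "x \<notin> N n" if "n0 \<le> n" for n
    proof
      assume "x \<in> N n"
      then obtain z where z: "z \<in> S" "dist z x < inverse (real (Suc n))" by (auto simp: N_def)
      moreover have "inverse (real (Suc n)) \<le> inverse (real (Suc n0))"
        using that by (intro le_imp_inverse_le) auto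
      ultimately have "dist z x < e" using n0 by linarith
      then have "z \<in> ball x e" by (simp add: dist_commute)
      then show False using e(2) z(1) S(4) by blast
    qed
    then show ?thesis by blast
  qed
  have "\<exists>\<eta>. C1_on UNIV \<eta> \<and> (\<forall>y. 0 \<le> \<eta> y \<and> \<eta> y \<le> 1) \<and> weak_divergence \<Omega> Y \<eta> = 0 \<and>
      (\<forall>y. y \<notin> N n \<longrightarrow> \<eta> y = 1 \<and> grad \<eta> y = 0) \<and> (\<forall>y. norm (grad \<eta> y) \<le> A * real (Suc n))" for n
  proof -
    have "0 < inverse (real (Suc n))" by simp
    from cutoff_near_bounded_set[OF S(1) this] obtain \<eta> where \<eta>: "C1_on UNIV \<eta>" "\<And>y. 0 \<le> \<eta> y" "\<And>y. \<eta> y \<le> 1"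
      "\<And>x y. x \<in> S \<Longrightarrow> dist x y < inverse (real (Suc n)) / 4 \<Longrightarrow> \<eta> y = 0"
      "\<And>y. y \<notin> N n \<Longrightarrow> \<eta> y = 1 \<and> grad \<eta> y = 0"
      "\<And>y. norm (grad \<eta> y) \<le> 9 ^ DIM('a) * (6 / inverse (real (Suc n)))"
      unfolding N_def by metis
    have "weak_divergence \<Omega> Y \<eta> = 0"
      by (rule weak_divergence_off_singular_boundary[OF \<Omega> Y(1,2) Y1 Y(4) \<eta>(1,2), of "inverse (real (Suc n)) / 4"])
        (use \<eta>(4) in \<open>auto simp: S_def\<close>)
    moreover have "norm (grad \<eta> y) \<le> A * real (Suc n)" for y
      using \<eta>(6)[of y] by (simp add: A_def field_simps)
    ultimately show ?thesis using \<eta> by blast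
  qed
  then obtain \<eta> where \<eta>: "\<And>n. C1_on UNIV (\<eta> n)" "\<And>n y. 0 \<le> \<eta> n y" "\<And>n y. \<eta> n y \<le> 1"
    "\<And>n. weak_divergence \<Omega> Y (\<eta> n) = 0" "\<And>n y. y \<notin> N n \<Longrightarrow> \<eta> n y = 1"
    "\<And>n y. y \<notin> N n \<Longrightarrow> grad (\<eta> n) y = 0" "\<And>n y. norm (grad (\<eta> n) y) \<le> A * real (Suc n)"
    by metis
  note \<eta>_int = set_integrable_weak_divergence[OF \<Omega> Y(1,2) Y1 \<eta>(1)]
  define D where "D = (LINT x:\<Omega>|lborel. divergence Y x)"
  define d where "d = (\<lambda>n. LINT x:\<Omega>|lborel. \<eta> n x * divergence Y x)"
  define I where "I = (\<lambda>n. LINT x:\<Omega>|lborel. indicator (N n) x * (norm (Y x))\<^sup>2)"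
  have d_lim: "d \<longlonglongrightarrow> D"
    unfolding D_def d_def set_lebesgue_integral_def
  proof (rule integral_dominated_convergence)
    show "(\<lambda>x. indicator \<Omega> x *\<^sub>R divergence Y x) \<in> borel_measurable lborel"
      "integrable lborel (\<lambda>x. norm (indicator \<Omega> x *\<^sub>R divergence Y x))"
      using Y(2) unfolding set_integrable_def by (auto intro: integrable_norm)
    show "(\<lambda>x. indicator \<Omega> x *\<^sub>R (\<eta> n x * divergence Y x)) \<in> borel_measurable lborel" for n
      using \<eta>_int(1)[of n] unfolding set_integrable_def by auto
    show "AE x in lborel. norm (indicator \<Omega> x *\<^sub>R (\<eta> n x * divergence Y x)) \<le> norm (indicator \<Omega> x *\<^sub>R divergence Y x)" for n
      using \<eta>(2,3) by (intro AE_I2) (auto simp: abs_mult indicator_def intro!: mult_left_le_one_le)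
    show "AE x in lborel. (\<lambda>n. indicator \<Omega> x *\<^sub>R (\<eta> n x * divergence Y x)) \<longlonglongrightarrow> indicator \<Omega> x *\<^sub>R divergence Y x"
    proof (rule AE_I2)
      fix x
      show "(\<lambda>n. indicator \<Omega> x *\<^sub>R (\<eta> n x * divergence Y x)) \<longlonglongrightarrow> indicator \<Omega> x *\<^sub>R divergence Y x"
      proof (cases "x \<in> \<Omega>")
        case True
        then obtain n0 where "\<forall>n\<ge>n0. x \<notin> N n" using leave by blast
        then show ?thesis
          using \<eta>(5) by (intro tendsto_eventually eventually_sequentiallyI[of n0]) simp
      qed simp
    qed
  qed
  have I_int: "set_integrable lborel \<Omega> (\<lambda>x. indicator (N n) x * (norm (Y x))\<^sup>2)" for n
  proof -
    have "set_integrable lborel (\<Omega> \<inter> N n) (\<lambda>x. (norm (Y x))\<^sup>2)"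
      using Nopen \<Omega>(1) by (intro set_integrable_subset[OF Y(3)]) auto
    then show ?thesis
      unfolding set_integrable_def by (simp add: indicator_inter_arith mult.assoc)
  qed
  have I_lim: "I \<longlonglongrightarrow> 0"
  proof -
    have "I \<longlonglongrightarrow> integral\<^sup>L lborel (\<lambda>x::'a. 0)"
      unfolding I_def set_lebesgue_integral_def
    proof (rule integral_dominated_convergence)
      show "integrable lborel (\<lambda>x. indicator \<Omega> x *\<^sub>R (norm (Y x))\<^sup>2)"
        using Y(3) unfolding set_integrable_def .
      show "(\<lambda>x. indicator \<Omega> x *\<^sub>R (indicator (N n) x * (norm (Y x))\<^sup>2)) \<in> borel_measurable lborel" for n
        using I_int[of n] unfolding set_integrable_def by auto
      show "AE x in lborel. norm (indicator \<Omega> x *\<^sub>R (indicator (N n) x * (norm (Y x))\<^sup>2)) \<le> indicator \<Omega> x *\<^sub>R (norm (Y x))\<^sup>2" for n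
        by (intro AE_I2) (auto simp: indicator_def)
      show "AE x in lborel. (\<lambda>n. indicator \<Omega> x *\<^sub>R (indicator (N n) x * (norm (Y x))\<^sup>2)) \<longlonglongrightarrow> 0"
      proof (rule AE_I2)
        fix x
        show "(\<lambda>n. indicator \<Omega> x *\<^sub>R (indicator (N n) x * (norm (Y x))\<^sup>2)) \<longlonglongrightarrow> 0"
        proof (cases "x \<in> \<Omega>")
          case True
          then obtain n0 where "\<forall>n\<ge>n0. x \<notin> N n" using leave by blast
          then show ?thesis
            by (intro tendsto_eventually eventually_sequentiallyI[of n0]) simp
        qed simp
      qed
    qed simp
    then show ?thesis by simp
  qed
  have le: "\<bar>d n\<bar> \<le> I n / (2 * t) + t * A\<^sup>2 * C / 2" if "0 < t" for n t
  proof -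
    define s where "s = A * real (Suc n)"
    have N1: "set_integrable lborel \<Omega> (\<lambda>x. indicator (N n) x :: real)"
    proof -
      have "set_integrable lborel (\<Omega> \<inter> N n) (\<lambda>x. 1 :: real)"
        using Nopen \<Omega> by (intro set_integrable_bounded_continuous[where B = 1]) auto
      then show ?thesis unfolding set_integrable_def by (simp add: indicator_inter_arith)
    qed
    have N1_le: "(LINT x:\<Omega>|lborel. indicator (N n) x :: real) \<le> measure lborel (N n)"
    proof -
      have "(LINT x:\<Omega>|lborel. indicator (N n) x :: real) = measure lborel (\<Omega> \<inter> N n)"
        unfolding set_lebesgue_integral_def by (simp add: indicator_inter_arith[symmetric])
      also have "\<dots> \<le> measure lborel (N n)"
        using Nopen Nbd[of n] \<Omega>(1) emeasure_bounded_finite[OF Nbd[of n]]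
        by (intro measure_mono_fmeasurable) (auto simp: fmeasurable_def)
      finally show ?thesis .
    qed
    have R_int: "set_integrable lborel \<Omega> (\<lambda>x. indicator (N n) x * (norm (Y x))\<^sup>2 / (2 * t))"
      "set_integrable lborel \<Omega> (\<lambda>x. t * s\<^sup>2 / 2 * indicator (N n) x)"
      using I_int N1 by auto
    have "0 = d n + (LINT x:\<Omega>|lborel. Y x \<bullet> grad (\<eta> n) x)"
      using \<eta>(4)[of n] set_integral_add(2)[OF \<eta>_int(1,2)] by (simp add: weak_divergence_def d_def)
    then have "\<bar>d n\<bar> = \<bar>LINT x:\<Omega>|lborel. Y x \<bullet> grad (\<eta> n) x\<bar>" by linarith
    also have "\<dots> \<le> (LINT x:\<Omega>|lborel. \<bar>Y x \<bullet> grad (\<eta> n) x\<bar>)"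
      using set_integral_norm_bound[OF \<eta>_int(2)] by simp
    also have "\<dots> \<le> (LINT x:\<Omega>|lborel. indicator (N n) x * (norm (Y x))\<^sup>2 / (2 * t) + t * s\<^sup>2 / 2 * indicator (N n) x)"
    proof (rule set_integral_mono)
      fix x assume "x \<in> \<Omega>"
      show "\<bar>Y x \<bullet> grad (\<eta> n) x\<bar> \<le> indicator (N n) x * (norm (Y x))\<^sup>2 / (2 * t) + t * s\<^sup>2 / 2 * indicator (N n) x"
      proof (cases "x \<in> N n")
        case True
        have "\<bar>Y x \<bullet> grad (\<eta> n) x\<bar> \<le> norm (Y x) * norm (grad (\<eta> n) x)" by (rule Cauchy_Schwarz_ineq2)
        also have "\<dots> \<le> norm (Y x) * s" using \<eta>(7) by (intro mult_left_mono) (auto simp: s_def)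
        also have "\<dots> \<le> (norm (Y x))\<^sup>2 / (2 * t) + t * s\<^sup>2 / 2"
        proof -
          have "0 \<le> (norm (Y x) - t * s)\<^sup>2 / (2 * t)" using \<open>0 < t\<close> by simp
          also have "\<dots> = (norm (Y x))\<^sup>2 / (2 * t) + t * s\<^sup>2 / 2 - norm (Y x) * s"
            using \<open>0 < t\<close> by (simp add: power2_eq_square field_simps)
          finally show ?thesis by simp
        qed
        finally show ?thesis using True by simp
      qed (simp add: \<eta>(6))
    qed (intro set_integrable_abs \<eta>_int(2) set_integral_add R_int)+
    also have "\<dots> = I n / (2 * t) + t * s\<^sup>2 / 2 * (LINT x:\<Omega>|lborel. indicator (N n) x)"
      using set_integral_add(2)[OF R_int] by (simp add: I_def)
    also have "\<dots> \<le> I n / (2 * t) + t * s\<^sup>2 / 2 * (C * (inverse (real (Suc n)))\<^sup>2)"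
      using \<open>0 < t\<close> order_trans[OF N1_le Nmeas] by (intro add_left_mono mult_left_mono) auto
    \<comment> \<open>Codimension two at work: the squared gradient bound (A (n + 1))^2 and the
      volume bound C / (n + 1)^2 cancel in n.\<close>
    also have "t * s\<^sup>2 / 2 * (C * (inverse (real (Suc n)))\<^sup>2) = t * A\<^sup>2 * C / 2"
      by (simp add: s_def power_mult_distrib power_inverse field_simps del: of_nat_Suc)
    finally show ?thesis .
  qed
  \<comment> \<open>First n tends to infinity with t fixed, which removes the energy term
    \<open>I n\<close>; only then does t tend to 0.\<close>
  have "\<bar>D\<bar> \<le> t * A\<^sup>2 * C / 2" if "0 < t" for t
  proof -
    have "(\<lambda>n. I n / (2 * t) + t * A\<^sup>2 * C / 2) \<longlonglongrightarrow> 0 / (2 * t) + t * A\<^sup>2 * C / 2"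
      using that by (intro tendsto_intros I_lim) auto
    then show ?thesis
      using LIMSEQ_le[OF tendsto_rabs[OF d_lim]] le[OF that] by (metis (no_types, lifting) add_0 div_0)
  qed
  moreover have "((\<lambda>t. t * A\<^sup>2 * C / 2) \<longlongrightarrow> 0 * A\<^sup>2 * C / 2) (at_right (0::real))"
    by (intro tendsto_intros) auto
  ultimately have "\<bar>D\<bar> \<le> 0"
    by (intro tendsto_lowerbound[of "\<lambda>t. t * A\<^sup>2 * C / 2" 0 "at_right 0"])
      (auto simp: eventually_at_right_field intro!: exI[of _ 1])
  then show ?thesis by (simp add: D_def)
qed

subsection \<open>Neumann eigenfunctions\<close>

lemma C1_field_on_diff: "C1_field_on S Y \<Longrightarrow> C1_field_on S Z \<Longrightarrow> C1_field_on S (\<lambda>x. Y x - Z x)"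
  by (simp add: C1_field_on_def C1_on_diff inner_diff_left)

lemma divergence_diff:
  assumes "C1_field_on S Y" "C1_field_on S Z" "x \<in> S"
  shows "divergence (\<lambda>x. Y x - Z x) x = divergence Y x - divergence Z x"
proof -
  have "grad (\<lambda>y. (Y y - Z y) \<bullet> b) x = grad (\<lambda>y. Y y \<bullet> b) x - grad (\<lambda>y. Z y \<bullet> b) x" if "b \<in> Basis" for b
    using assms that by (simp add: C1_field_on_def inner_diff_left grad_diff[of S])
  then show ?thesis by (simp add: divergence_def inner_diff_left sum_subtractf)
qed

text \<open>The set where \<open>f\<close> is positive is open and null, hence empty.\<close>

lemma set_integral_nonneg_eq_0_continuous:
  fixes f :: "'a::euclidean_space \<Rightarrow> real"
  assumes \<Omega>: "open \<Omega>" and f: "continuous_on \<Omega> f" "\<And>x. x \<in> \<Omega> \<Longrightarrow> 0 \<le> f x"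
    "set_integrable lborel \<Omega> f" "(LINT x:\<Omega>|lborel. f x) = 0" and "x \<in> \<Omega>"
  shows "f x = 0"
proof (rule ccontr)
  assume "f x \<noteq> 0"
  have "AE y in lborel. indicator \<Omega> y *\<^sub>R f y = 0"
    using f integral_nonneg_eq_0_iff_AE[of lborel "\<lambda>y. indicator \<Omega> y *\<^sub>R f y"]
    unfolding set_integrable_def set_lebesgue_integral_def by (auto simp: indicator_def)
  then have "AE y in lborel. y \<notin> \<Omega> \<inter> f -` {0<..}"
    by (rule AE_mp) (auto simp: indicator_def)
  moreover have op: "open (\<Omega> \<inter> f -` {0<..})"
    using f(1) \<Omega> by (intro continuous_open_preimage) auto
  ultimately have "\<Omega> \<inter> f -` {0<..} \<in> null_sets lborel"
    by (subst (asm) AE_iff_null_sets[symmetric]) auto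
  then have "negligible (\<Omega> \<inter> f -` {0<..})"
    by (simp add: negligible_iff_null_sets null_sets_completionI)
  moreover have "x \<in> \<Omega> \<inter> f -` {0<..}"
    using f(2)[OF \<open>x \<in> \<Omega>\<close>] \<open>f x \<noteq> 0\<close> \<open>x \<in> \<Omega>\<close> by simp
  ultimately show False using open_not_negligible[OF op] by blast
qed

text \<open>Near x the values of \<open>g\<close> stay within pi of \<open>g x\<close>, so
  \<open>g\<close> = \<open>g x\<close> + Ln(u / u x) with the principal branch, differentiated at 1
  away from its cut. The formula is the imaginary part of du / u, with u = \<phi> + i
  \<psi>.\<close>

lemma GDERIV_continuous_argument:
  fixes \<phi> \<psi> :: "'a::euclidean_space \<Rightarrow> real"
  assumes \<Omega>: "open \<Omega>" "x \<in> \<Omega>" and g: "continuous_on \<Omega> g"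
    and eq: "\<And>y. y \<in> \<Omega> \<Longrightarrow> Complex (\<phi> y) (\<psi> y) = exp (g y)"
    and d: "GDERIV \<phi> x :> a" "GDERIV \<psi> x :> b"
  shows "GDERIV (\<lambda>y. Im (g y)) x :> (\<phi> x *\<^sub>R b - \<psi> x *\<^sub>R a) /\<^sub>R ((\<phi> x)\<^sup>2 + (\<psi> x)\<^sup>2)"
proof -
  define u where "u = (\<lambda>y. complex_of_real (\<phi> y) + \<i> * complex_of_real (\<psi> y))"
  have u: "u y = exp (g y)" if "y \<in> \<Omega>" for y
    using eq[OF that] by (simp add: u_def complex_eq_iff)
  have ux: "u x \<noteq> 0" using u[OF \<Omega>(2)] by simp
  have "isCont g x" using g \<Omega> by (simp add: continuous_on_eq_continuous_at)
  then obtain \<delta> where \<delta>: "0 < \<delta>" "\<And>y. dist y x < \<delta> \<Longrightarrow> dist (g y) (g x) < pi"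
    unfolding continuous_at_eps_delta using pi_gt_zero by blast
  have g_Ln: "g x + Ln (u y / u x) = g y" if "y \<in> \<Omega> \<inter> ball x \<delta>" for y
  proof -
    have "\<bar>Im (g y - g x)\<bar> < pi"
      using \<delta>(2)[of y] that abs_Im_le_cmod[of "g y - g x"] by (auto simp: dist_norm norm_minus_commute)
    moreover have "u y / u x = exp (g y - g x)" using u that \<Omega>(2) by (simp add: exp_diff)
    ultimately show ?thesis by simp
  qed
  have "(u has_derivative (\<lambda>h. complex_of_real (h \<bullet> a) + \<i> * complex_of_real (h \<bullet> b))) (at x)"
    using d unfolding u_def gderiv_def by (auto intro!: derivative_eq_intros)
  then have "((\<lambda>y. u y / u x) has_derivative
      (\<lambda>h. (complex_of_real (h \<bullet> a) + \<i> * complex_of_real (h \<bullet> b)) / u x)) (at x)"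
    by (rule bounded_linear.has_derivative[OF bounded_linear_divide])
  moreover have "(Ln has_derivative (*) 1) (at (u x / u x))"
    using has_field_derivative_Ln[of 1] ux by (simp add: has_field_derivative_def)
  ultimately have "((\<lambda>y. Ln (u y / u x)) has_derivative
      (\<lambda>h. 1 * ((complex_of_real (h \<bullet> a) + \<i> * complex_of_real (h \<bullet> b)) / u x))) (at x)"
    by (rule has_derivative_compose)
  then have "((\<lambda>y. Im (g x + Ln (u y / u x))) has_derivative
      (\<lambda>h. Im ((complex_of_real (h \<bullet> a) + \<i> * complex_of_real (h \<bullet> b)) / u x))) (at x)"
    by (intro has_derivative_Im) (auto intro!: derivative_eq_intros)
  moreover have "Im ((complex_of_real (h \<bullet> a) + \<i> * complex_of_real (h \<bullet> b)) / u x) =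
      h \<bullet> ((\<phi> x *\<^sub>R b - \<psi> x *\<^sub>R a) /\<^sub>R ((\<phi> x)\<^sup>2 + (\<psi> x)\<^sup>2))" for h
    by (simp add: u_def Im_divide inner_diff_right divide_inverse algebra_simps)
  ultimately have "((\<lambda>y. Im (g x + Ln (u y / u x))) has_derivative
      (\<lambda>h. h \<bullet> ((\<phi> x *\<^sub>R b - \<psi> x *\<^sub>R a) /\<^sub>R ((\<phi> x)\<^sup>2 + (\<psi> x)\<^sup>2)))) (at x)" by simp
  then show ?thesis
    unfolding gderiv_def
    by (rule has_derivative_transform_within_open[where s = "\<Omega> \<inter> ball x \<delta>"])
      (use \<Omega> \<delta>(1) g_Ln in auto)
qed

lemma laplacian_eq_divergence_grad: "laplacian f x = divergence (grad f) x"
  by (simp add: laplacian_def divergence_def)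

lemma C2_onD: "C2_on S f \<Longrightarrow> C1_on S f" "C2_on S f \<Longrightarrow> C1_field_on S (grad f)"
  by (auto simp: C2_on_def C1_field_on_def)

lemma neumann_eigenfunctionD:
  assumes "neumann_eigenfunction \<Omega> \<mu> f"
  shows "\<exists>x\<in>\<Omega>. f x \<noteq> 0" "continuous_on (closure \<Omega>) f" "C1_on \<Omega> f" "C1_field_on \<Omega> (grad f)"
    "\<And>x. x \<in> \<Omega> \<Longrightarrow> divergence (grad f) x = - \<mu> * f x" "neumann_condition \<Omega> f"
    "set_integrable lborel \<Omega> (\<lambda>x. (norm (grad f x))\<^sup>2)"
  using assms C2_onD unfolding neumann_eigenfunction_def laplacian_eq_divergence_grad[symmetric]
  by (auto simp: minus_equation_iff)

text \<open>Integrating the eigenvalue equation turns its left side into the flux of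
  \<open>grad f\<close>, which the Neumann condition makes zero; division by \<mu> remains.\<close>

lemma set_integral_eigenfunction_eq_0:
  fixes \<Omega> :: "'a::euclidean_space set"
  assumes \<Omega>: "open \<Omega>" "bounded \<Omega>" "piecewise_C1_boundary \<Omega>" and "\<mu> \<noteq> 0"
    and f: "neumann_eigenfunction \<Omega> \<mu> f"
  shows "set_integrable lborel \<Omega> f" "(LINT x:\<Omega>|lborel. f x) = 0"
proof -
  note f = neumann_eigenfunctionD[OF f]
  obtain C where C: "\<forall>\<epsilon>. 0 < \<epsilon> \<and> \<epsilon> \<le> 1 \<longrightarrow>
      measure lebesgue (\<Union>x\<in>singular_boundary \<Omega>. ball x \<epsilon>) \<le> C * \<epsilon>\<^sup>2"
    using \<Omega>(3) unfolding piecewise_C1_boundary_def by blast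
  have "bounded (f ` closure \<Omega>)"
    using f(2) \<Omega>(2) by (intro compact_imp_bounded compact_continuous_image) auto
  then obtain B where "\<And>x. x \<in> closure \<Omega> \<Longrightarrow> \<bar>f x\<bar> \<le> B" by (auto simp: bounded_iff)
  then show int: "set_integrable lborel \<Omega> f"
    using closure_subset continuous_on_subset[OF f(2) closure_subset]
    by (intro set_integrable_bounded_continuous[OF \<Omega>(1,2), where B = B]) auto
  obtain G where G: "continuous_on (\<Omega> \<union> regular_boundary \<Omega>) G" "\<And>x. x \<in> \<Omega> \<Longrightarrow> G x = grad f x"
    "\<And>x \<nu>. outward_unit_normal \<Omega> x \<nu> \<Longrightarrow> G x \<bullet> \<nu> = 0"
    using f(6) unfolding neumann_condition_def by blast
  have div_int: "set_integrable lborel \<Omega> (divergence (grad f))"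
  proof (subst set_integrable_cong[OF refl refl f(5)])
    show "set_integrable lborel \<Omega> (\<lambda>x. - \<mu> * f x)" by (rule set_integrable_mult_right) (rule int)
  qed
  have "0 = (LINT x:\<Omega>|lborel. divergence (grad f) x)"
  proof (rule integral_divergence_tangential[symmetric, OF \<Omega>(1,2) _ f(4) div_int f(7)])
    show "tangential_at_boundary \<Omega> (grad f)"
      unfolding tangential_at_boundary_def using G by (intro exI[of _ G]) auto
  qed (use C in blast)
  also have "\<dots> = (LINT x:\<Omega>|lborel. - \<mu> * f x)"
    using f(5) \<Omega>(1) by (intro set_lebesgue_integral_cong) auto
  also have "\<dots> = - \<mu> * (LINT x:\<Omega>|lborel. f x)" by (rule set_integral_mult_right)
  finally show "(LINT x:\<Omega>|lborel. f x) = 0" using \<open>\<mu> \<noteq> 0\<close> by simp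
qed

text \<open>Testing with \<open>arctan \<theta>\<close> instead of \<open>\<theta>\<close> avoids having to bound the argument \<open>\<theta>\<close>
  near the boundary.\<close>

lemma wronskian_field_eq_0:
  fixes \<Omega> :: "'a::euclidean_space set"
  assumes \<Omega>: "open \<Omega>" "bounded \<Omega>" "piecewise_C1_boundary \<Omega>"
    and \<phi>: "neumann_eigenfunction \<Omega> \<mu> \<phi>" and \<psi>: "neumann_eigenfunction \<Omega> \<mu> \<psi>"
    and disj: "nodal_set \<Omega> \<phi> \<inter> nodal_set \<Omega> \<psi> = {}"
    and \<theta>: "\<And>x. x \<in> \<Omega> \<Longrightarrow>
      GDERIV \<theta> x :> (\<phi> x *\<^sub>R grad \<psi> x - \<psi> x *\<^sub>R grad \<phi> x) /\<^sub>R ((\<phi> x)\<^sup>2 + (\<psi> x)\<^sup>2)"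
    and "x \<in> \<Omega>"
  shows "\<phi> x *\<^sub>R grad \<psi> x - \<psi> x *\<^sub>R grad \<phi> x = 0"
proof -
  note \<phi> = neumann_eigenfunctionD[OF \<phi>] and \<psi> = neumann_eigenfunctionD[OF \<psi>]
  obtain C where C: "\<forall>\<epsilon>. 0 < \<epsilon> \<and> \<epsilon> \<le> 1 \<longrightarrow>
      measure lebesgue (\<Union>x\<in>singular_boundary \<Omega>. ball x \<epsilon>) \<le> C * \<epsilon>\<^sup>2"
    using \<Omega>(3) unfolding piecewise_C1_boundary_def by blast
  define q where "q = (\<lambda>x. (\<phi> x)\<^sup>2 + (\<psi> x)\<^sup>2)"
  have q_cont: "continuous_on (closure \<Omega>) q" unfolding q_def by (intro continuous_intros \<phi>(2) \<psi>(2))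
  \<comment> \<open>Nodal sets include boundary points, so \<open>q\<close> = |u|^2 is positive on
    the compact closure and has a positive lower bound \<open>m\<close> there. This bounds the
    weight \<open>w\<close> below by which |X|^2 is multiplied.\<close>
  have q_pos: "0 < q x" if "x \<in> closure \<Omega>" for x
    using disj that unfolding q_def nodal_set_def by (auto simp: sum_power2_gt_zero_iff)
  have cl: "compact (closure \<Omega>)" "closure \<Omega> \<noteq> {}" using \<Omega>(2) \<open>x \<in> \<Omega>\<close> closure_subset by auto
  obtain m where m: "0 < m" "\<And>x. x \<in> \<Omega> \<Longrightarrow> m \<le> q x"
    using continuous_attains_inf[OF cl q_cont] q_pos closure_subset by (metis subsetD)
  obtain M where M: "0 < M" "\<And>x. x \<in> \<Omega> \<Longrightarrow> q x \<le> M"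
    using continuous_attains_sup[OF cl q_cont] q_pos closure_subset by (metis subsetD)
  define X where "X = (\<lambda>x. \<phi> x *\<^sub>R grad \<psi> x - \<psi> x *\<^sub>R grad \<phi> x)"
  have X: "C1_field_on \<Omega> X"
    unfolding X_def by (intro C1_field_on_diff C1_field_on_scaleR \<phi> \<psi>)
  have X_cont: "continuous_on \<Omega> X" using X by (rule C1_field_on_imp_continuous_on)
  \<comment> \<open>The inner products of the gradients cancel by symmetry, and \<phi>
    \<Delta>\<psi> - \<psi> \<Delta>\<phi> vanishes because the eigenvalue is the same.\<close>
  have X_div: "divergence X x = 0" if "x \<in> \<Omega>" for x
    unfolding X_def
    using divergence_diff[OF C1_field_on_scaleR[OF \<phi>(3) \<psi>(4)] C1_field_on_scaleR[OF \<psi>(3) \<phi>(4)] that]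
      divergence_scaleR[OF \<phi>(3) \<psi>(4) that] divergence_scaleR[OF \<psi>(3) \<phi>(4) that] \<phi>(5)[OF that] \<psi>(5)[OF that]
    by (simp add: inner_commute)
  have X_int: "set_integrable lborel \<Omega> (\<lambda>x. (norm (X x))\<^sup>2)"
  proof (rule set_integrable_continuous_bound[OF \<Omega>(1)])
    let ?g = "\<lambda>x. 2 * M * ((norm (grad \<psi> x))\<^sup>2 + (norm (grad \<phi> x))\<^sup>2)"
    show "set_integrable lborel \<Omega> ?g" using \<phi>(7) \<psi>(7) by (intro set_integrable_mult_right set_integral_add) auto
    show "\<bar>(norm (X x))\<^sup>2\<bar> \<le> \<bar>?g x\<bar>" if "x \<in> \<Omega>" for x
    proof -
      let ?a = "\<bar>\<phi> x\<bar> * norm (grad \<psi> x)" and ?b = "\<bar>\<psi> x\<bar> * norm (grad \<phi> x)"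
      have "norm (X x) \<le> ?a + ?b" unfolding X_def
        using norm_triangle_ineq4[of "\<phi> x *\<^sub>R grad \<psi> x" "\<psi> x *\<^sub>R grad \<phi> x"] by simp
      then have "(norm (X x))\<^sup>2 \<le> (?a + ?b)\<^sup>2" by (intro power_mono) auto
      also have "\<dots> \<le> 2 * (?a\<^sup>2 + ?b\<^sup>2)"
        using zero_le_power2[of "?a - ?b"] by (simp only: power2_sum power2_diff) (simp add: algebra_simps)
      also have "?a\<^sup>2 + ?b\<^sup>2 = (\<phi> x)\<^sup>2 * (norm (grad \<psi> x))\<^sup>2 + (\<psi> x)\<^sup>2 * (norm (grad \<phi> x))\<^sup>2"
        by (simp add: power_mult_distrib)
      also have "2 * \<dots> \<le> 2 * (M * (norm (grad \<psi> x))\<^sup>2 + M * (norm (grad \<phi> x))\<^sup>2)"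
        using M(2)[OF that] zero_le_power2[of "\<phi> x"] zero_le_power2[of "\<psi> x"] unfolding q_def
        by (intro mult_left_mono add_mono mult_right_mono zero_le_power2) linarith+
      also have "\<dots> = ?g x" by (simp add: algebra_simps)
      finally show ?thesis by simp
    qed
  qed (intro continuous_intros X_cont)
  have grad_\<theta>: "grad \<theta> x = X x /\<^sub>R q x" if "x \<in> \<Omega>" for x
    using \<theta>[OF that] unfolding X_def q_def by (rule grad_eqI)
  have "continuous_on \<Omega> (\<lambda>x. X x /\<^sub>R q x)"
    using q_pos closure_subset
    by (intro continuous_intros X_cont continuous_on_subset[OF q_cont]) force+
  then have \<theta>C1: "C1_on \<Omega> \<theta>"
    using \<theta> by (intro C1_onI[of \<Omega> \<theta> "\<lambda>x. X x /\<^sub>R q x"]) (auto simp: X_def q_def)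
  define h where "h = (\<lambda>x. arctan (\<theta> x))"
  have hC1: "C1_on \<Omega> h"
    unfolding h_def
    by (rule C1_on_compose[OF \<theta>C1 DERIV_arctan]) (auto intro!: continuous_intros simp: add_nonneg_eq_0_iff)
  have grad_h: "grad h x = inverse (1 + (\<theta> x)\<^sup>2) *\<^sub>R X x /\<^sub>R q x" if "x \<in> \<Omega>" for x
    unfolding h_def using grad_compose[OF \<theta>C1 that DERIV_arctan] grad_\<theta>[OF that] by simp
  have h_le: "\<bar>h x\<bar> \<le> 2" for x
    using arctan_bounded[of "\<theta> x"] pi_less_4 unfolding h_def by (simp add: abs_le_iff)
  define Y where "Y = (\<lambda>x. h x *\<^sub>R X x)"
  have Y: "C1_field_on \<Omega> Y" unfolding Y_def by (intro C1_field_on_scaleR hC1 X)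
  define w where "w = (\<lambda>x. inverse (1 + (\<theta> x)\<^sup>2) * inverse (q x))"
  have Y_div: "divergence Y x = w x * (norm (X x))\<^sup>2" if "x \<in> \<Omega>" for x
    unfolding Y_def using divergence_scaleR[OF hC1 X that] X_div[OF that] grad_h[OF that]
    by (simp add: w_def power2_norm_eq_inner mult_ac)
  have w: "0 < w x" "w x \<le> inverse m" if "x \<in> \<Omega>" for x
  proof -
    have q: "0 < q x" using m that by fastforce
    have s: "0 < 1 + (\<theta> x)\<^sup>2" by (simp add: add_pos_nonneg)
    then show "0 < w x" using q by (simp add: w_def)
    have "w x \<le> 1 * inverse m"
      unfolding w_def using q s m that
      by (intro mult_mono) (auto simp: inverse_le_1_iff intro: le_imp_inverse_le)
    then show "w x \<le> inverse m" by simp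
  qed
  have div_int: "set_integrable lborel \<Omega> (divergence Y)"
  proof (rule set_integrable_continuous_bound[OF \<Omega>(1) continuous_on_divergence[OF Y]])
    show "set_integrable lborel \<Omega> (\<lambda>x. inverse m * (norm (X x))\<^sup>2)" using X_int by simp
    show "\<bar>divergence Y x\<bar> \<le> \<bar>inverse m * (norm (X x))\<^sup>2\<bar>" if "x \<in> \<Omega>" for x
      unfolding Y_div[OF that] abs_mult using w[OF that] m(1) by (intro mult_right_mono) auto
  qed
  have "(LINT x:\<Omega>|lborel. divergence Y x) = 0"
  proof (rule integral_divergence_tangential[OF \<Omega>(1,2) _ Y div_int])
    show "set_integrable lborel \<Omega> (\<lambda>x. (norm (Y x))\<^sup>2)"
    proof (rule set_integrable_continuous_bound[OF \<Omega>(1)])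
      show "set_integrable lborel \<Omega> (\<lambda>x. 4 * (norm (X x))\<^sup>2)" using X_int by simp
      show "\<bar>(norm (Y x))\<^sup>2\<bar> \<le> \<bar>4 * (norm (X x))\<^sup>2\<bar>" for x
      proof -
        have "norm (Y x) \<le> 2 * norm (X x)" unfolding Y_def using h_le by (simp add: mult_right_mono)
        then have "(norm (Y x))\<^sup>2 \<le> (2 * norm (X x))\<^sup>2" by (intro power_mono) auto
        then show ?thesis by (simp add: power_mult_distrib)
      qed
    qed (intro continuous_intros C1_field_on_imp_continuous_on[OF Y])
    obtain G H where G: "continuous_on (\<Omega> \<union> regular_boundary \<Omega>) G" "\<And>x. x \<in> \<Omega> \<Longrightarrow> G x = grad \<phi> x"
      "\<And>x \<nu>. outward_unit_normal \<Omega> x \<nu> \<Longrightarrow> G x \<bullet> \<nu> = 0"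
      and H: "continuous_on (\<Omega> \<union> regular_boundary \<Omega>) H" "\<And>x. x \<in> \<Omega> \<Longrightarrow> H x = grad \<psi> x"
      "\<And>x \<nu>. outward_unit_normal \<Omega> x \<nu> \<Longrightarrow> H x \<bullet> \<nu> = 0"
      using \<phi>(6) \<psi>(6) unfolding neumann_condition_def by blast
    have sub: "\<Omega> \<union> regular_boundary \<Omega> \<subseteq> closure \<Omega>"
      using closure_subset by (auto simp: regular_boundary_def frontier_def)
    \<comment> \<open>\<theta>, and with it \<open>Y\<close>, may have no boundary values.
      \<open>E\<close> extends 2 X to the regular boundary, and the factor 2 bounds |arctan|, so
      \<open>E\<close> dominates \<open>Y\<close> in every direction.\<close>
    define E where "E = (\<lambda>x. 2 *\<^sub>R (\<phi> x *\<^sub>R H x - \<psi> x *\<^sub>R G x))"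
    show "tangential_at_boundary \<Omega> Y"
      unfolding tangential_at_boundary_def
    proof (intro exI[of _ E] conjI allI impI ballI)
      show "continuous_on (\<Omega> \<union> regular_boundary \<Omega>) E"
        unfolding E_def
        by (intro continuous_intros G(1) H(1) continuous_on_subset[OF \<phi>(2) sub] continuous_on_subset[OF \<psi>(2) sub])
      show "E x \<bullet> \<nu> = 0" if "outward_unit_normal \<Omega> x \<nu>" for x \<nu>
        using G(3)[OF that] H(3)[OF that] by (simp add: E_def inner_diff_left)
      show "\<bar>Y x \<bullet> v\<bar> \<le> \<bar>E x \<bullet> v\<bar>" if "x \<in> \<Omega>" for x v
      proof -
        have "E x = 2 *\<^sub>R X x" using G(2) H(2) that by (simp add: E_def X_def)
        then show ?thesis using h_le[of x] by (simp add: Y_def abs_mult mult_right_mono)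
      qed
    qed
  qed (use C in blast)
  moreover have "0 \<le> divergence Y x" if "x \<in> \<Omega>" for x
    using w(1)[OF that] by (simp add: Y_div[OF that])
  ultimately have "divergence Y x = 0"
    using set_integral_nonneg_eq_0_continuous[OF \<Omega>(1) continuous_on_divergence[OF Y] _ div_int] \<open>x \<in> \<Omega>\<close> by blast
  then have "X x = 0" using w(1)[OF \<open>x \<in> \<Omega>\<close>] by (simp add: Y_div[OF \<open>x \<in> \<Omega>\<close>])
  then show ?thesis by (simp add: X_def)
qed

theorem proposition5p2:
  fixes \<Omega> :: "(real ^ 'n) set" and \<mu> :: real and \<phi> \<psi> :: "real ^ 'n \<Rightarrow> real"
  assumes "open \<Omega>" and "connected \<Omega>" and "\<Omega> \<noteq> {}" and "bounded \<Omega>"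
    and "piecewise_C1_boundary \<Omega>"
    and "\<mu> \<noteq> 0"
    and "neumann_eigenfunction \<Omega> \<mu> \<phi>"
    and "neumann_eigenfunction \<Omega> \<mu> \<psi>"
    and "nodal_set \<Omega> \<phi> \<inter> nodal_set \<Omega> \<psi> = {}"
  shows "\<not> trivial_group (homology_group 1 (top_of_set \<Omega>))"
proof
  assume H1: "trivial_group (homology_group 1 (top_of_set \<Omega>))"
  note \<phi> = neumann_eigenfunctionD[OF assms(7)] and \<psi> = neumann_eigenfunctionD[OF assms(8)]
  define u where "u = (\<lambda>x. Complex (\<phi> x) (\<psi> x))"
  have "continuous_on \<Omega> u"
    unfolding u_def Complex_eq
    by (intro continuous_intros C1_on_imp_continuous_on \<phi>(3) \<psi>(3))
  moreover have "u x \<noteq> 0" if "x \<in> \<Omega>" for x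
    using that assms(9) closure_subset by (auto simp: u_def nodal_set_def complex_eq_iff)
  moreover have "path_connected \<Omega>" "locally path_connected \<Omega>"
    using assms(1,2) by (auto simp: connected_open_path_connected open_imp_locally_path_connected)
  ultimately obtain g where g: "continuous_on \<Omega> g" "\<And>x. x \<in> \<Omega> \<Longrightarrow> u x = exp (g x)"
    using continuous_logarithm_on_trivial_homology H1 by blast
  have \<theta>: "GDERIV (\<lambda>y. Im (g y)) x :> (\<phi> x *\<^sub>R grad \<psi> x - \<psi> x *\<^sub>R grad \<phi> x) /\<^sub>R ((\<phi> x)\<^sup>2 + (\<psi> x)\<^sup>2)"
    if "x \<in> \<Omega>" for x
    using that g \<phi>(3) \<psi>(3) by (intro GDERIV_continuous_argument[OF assms(1)]) (auto simp: u_def C1_onD)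
  have "((\<lambda>y. Im (g y)) has_derivative (\<lambda>h. 0)) (at x)" if "x \<in> \<Omega>" for x
    using \<theta>[OF that] wronskian_field_eq_0[OF assms(1,4,5,7,8,9) \<theta> that] by (simp add: gderiv_def)
  then obtain t where t: "\<And>x. x \<in> \<Omega> \<Longrightarrow> Im (g x) = t"
    using has_derivative_zero_unique_connected[OF assms(1,2)] assms(3) by (metis ex_in_conv)
  have \<phi>_eq: "\<phi> x = exp (Re (g x)) * cos t" if "x \<in> \<Omega>" for x
  proof -
    have "\<phi> x = Re (u x)" by (simp add: u_def)
    then show ?thesis using g(2)[OF that] t[OF that] by (simp add: Re_exp)
  qed
  obtain x where x: "x \<in> \<Omega>" "\<phi> x \<noteq> 0" using \<phi>(1) by blast
  then have "cos t \<noteq> 0" using \<phi>_eq by auto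
  note int = set_integral_eigenfunction_eq_0[OF assms(1,4,5,6,7)]
  \<comment> \<open>With the argument constantly t, \<phi> equals |u| cos t. The extra factor cos t
    gives |u| (cos t)^2, nonnegative whatever the sign of \<phi>, so the zero integral forces it to
    vanish.\<close>
  have "cos t * \<phi> x = 0"
  proof (rule set_integral_nonneg_eq_0_continuous[OF assms(1) _ _ _ _ x(1)])
    show "continuous_on \<Omega> (\<lambda>y. cos t * \<phi> y)" by (intro continuous_intros C1_on_imp_continuous_on \<phi>(3))
    show "set_integrable lborel \<Omega> (\<lambda>y. cos t * \<phi> y)" using int(1) by simp
    show "(LINT y:\<Omega>|lborel. cos t * \<phi> y) = 0" using int(2) by simp
    show "0 \<le> cos t * \<phi> y" if "y \<in> \<Omega>" for y
    proof -
      have "cos t * \<phi> y = exp (Re (g y)) * (cos t)\<^sup>2"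
        using \<phi>_eq[OF that] by (simp add: power2_eq_square)
      then show ?thesis by simp
    qed
  qed
  then show False using \<open>cos t \<noteq> 0\<close> x(2) by simp
qed

end
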